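(* Let $X,Y\in\Sigma^{\le n}$ and let $k\ge 0$ and $p$ be integers with $2\ln n\le p\le n$. Consider the following randomized procedure: set $x:=0$, $y:=0$, $c:=0$; while $x<|X|$ and $y<|Y|$: draw a fresh independent bit $s$ with $\Pr[s=1]=\frac{2\ln n}{p}$; if $s=1$ and $X[x]\ne Y[y]$, draw a fresh independent unbiased bit $r\in\{0,1\}$ and set $x:=x+r$, $y:=y+(1-r)$, $c:=c+1$; otherwise set $x:=x+1$ and $y:=y+1$. After the loop, return YES if $c+\max(|X|-x,|Y|-y)\le 1296k^2$ and NO otherwise. Then this procedure returns YES with probability at least $\frac23$ if $\mathsf{ED}(X,Y)\le k$, and returns NO with probability at least $1-\frac1n$ if $\mathsf{ED}(X,Y)\ge(1296k^2+1)p$. Moreover, the procedure can be implemented in $\tilde{\mathcal{O}}(\frac{n}{p})$ time.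
   Context: Strings are indexed from $0$; $\Sigma^{\le n}$ is the set of strings over alphabet $\Sigma$ of length at most $n$; random access to characters of $X,Y$ is available. $\mathsf{ED}$ denotes edit distance (insertions, deletions, substitutions). $\tilde{\mathcal{O}}$ hides factors polylogarithmic in $n$ (and in the inverse error probability). *)

theory Defs
  imports "HOL-Probability.Probability"
begin

section \<open>Edit distance\<close>

inductive single_edit :: "'a list \<Rightarrow> 'a list \<Rightarrow> bool" where
  insertion: "single_edit (us @ vs) (us @ a # vs)"
| deletion: "single_edit (us @ a # vs) (us @ vs)"
| substitution: "single_edit (us @ a # vs) (us @ b # vs)"

definition edit_distance :: "'a list \<Rightarrow> 'a list \<Rightarrow> nat" where
  "edit_distance X Y = (LEAST m. (single_edit ^^ m) X Y)"


section \<open>The randomized procedure\<close>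

datatype answer = YES | NO

text \<open>
  The loop of the procedure, started from the values \<open>x\<close>, \<open>y\<close>, \<open>c\<close> of its variables; the result
  is the joint distribution of their final values. The parameter \<open>q\<close> is the probability of \<open>s = 1\<close>.
\<close>
function walk_loop ::
    "real \<Rightarrow> 'a list \<Rightarrow> 'a list \<Rightarrow> nat \<Rightarrow> nat \<Rightarrow> nat \<Rightarrow> (nat \<times> nat \<times> nat) pmf" where
  "walk_loop q X Y x y c =
     (if x < length X \<and> y < length Y then
        bind_pmf (bernoulli_pmf q) (\<lambda>s.
          if s \<and> X ! x \<noteq> Y ! y then
            bind_pmf (bernoulli_pmf (1/2)) (\<lambda>r.
              walk_loop q X Y (x + of_bool r) (y + (1 - of_bool r)) (c + 1))
          else walk_loop q X Y (x + 1) (y + 1) c)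
      else return_pmf (x, y, c))"
  by pat_completeness auto
termination
  by (relation "Wellfounded.measure (\<lambda>(q, X, Y, x, y, c). (length X - x) + (length Y - y))") auto

definition walk_test :: "nat \<Rightarrow> nat \<Rightarrow> nat \<Rightarrow> 'a list \<Rightarrow> 'a list \<Rightarrow> answer pmf" where
  "walk_test n p k X Y =
     map_pmf (\<lambda>(x, y, c).
         if c + max (length X - x) (length Y - y) \<le> 1296 * k\<^sup>2 then YES else NO)
       (walk_loop (2 * ln (real n) / real p) X Y 0 0 0)"


section \<open>A randomized word RAM with random access to two strings\<close>

text \<open>
  Programs of a small imperative language over word registers and real registers. A word holds a
  natural number below \<open>2 ^ w\<close>, where the word length \<open>w\<close> is a parameter of the semantics. The strings
  are accessible only through the test \<open>Match a b\<close>, which compares a character of \<open>X\<close> with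
  one of \<open>Y\<close> at computed positions.

  The procedure draws bits of irrational bias, so the machine can draw a bit with a bias
  computed by exact arithmetic. The real registers serve only to compute these biases:
  control flow cannot test them, and they cannot be converted back to words. There is no
  addressable memory, and the only randomness is the drawing of single bits; both only
  restrict the machine, and so strengthen a statement that a program exists.
\<close>

datatype wexp =
  Const nat
| Word nat
| Add wexp wexp
| Sub wexp wexp
| Mul wexp wexp

datatype test =
  Less wexp wexp
| Match wexp wexp
| Neg test
| Conj test test

datatype rexp =
  OfWord wexp
| Real nat
| RAdd rexp rexp
| RSub rexp rexp
| RMul rexp rexp
| RDiv rexp rexp
| RLn rexp

datatype com =
  SetWord nat wexp
| SetReal nat rexp
| Flip nat rexp
| Seq com com
| If test com com
| While test com

record store =
  words :: "nat \<Rightarrow> nat"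
  reals :: "nat \<Rightarrow> real"

text \<open>Addition and multiplication wrap around; subtraction is truncated at \<open>0\<close>.\<close>
primrec wval :: "nat \<Rightarrow> wexp \<Rightarrow> store \<Rightarrow> nat" where
  "wval w (Const m) \<sigma> = m mod 2 ^ w"
| "wval w (Word i) \<sigma> = words \<sigma> i"
| "wval w (Add a b) \<sigma> = (wval w a \<sigma> + wval w b \<sigma>) mod 2 ^ w"
| "wval w (Sub a b) \<sigma> = wval w a \<sigma> - wval w b \<sigma>"
| "wval w (Mul a b) \<sigma> = (wval w a \<sigma> * wval w b \<sigma>) mod 2 ^ w"

primrec tval :: "nat \<Rightarrow> 'a list \<Rightarrow> 'a list \<Rightarrow> test \<Rightarrow> store \<Rightarrow> bool" where
  "tval w X Y (Less a b) \<sigma> \<longleftrightarrow> wval w a \<sigma> < wval w b \<sigma>"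
| "tval w X Y (Match a b) \<sigma> \<longleftrightarrow>
     wval w a \<sigma> < length X \<and> wval w b \<sigma> < length Y \<and> X ! wval w a \<sigma> = Y ! wval w b \<sigma>"
| "tval w X Y (Neg t) \<sigma> \<longleftrightarrow> \<not> tval w X Y t \<sigma>"
| "tval w X Y (Conj t u) \<sigma> \<longleftrightarrow> tval w X Y t \<sigma> \<and> tval w X Y u \<sigma>"

primrec rval :: "nat \<Rightarrow> rexp \<Rightarrow> store \<Rightarrow> real" where
  "rval w (OfWord a) \<sigma> = real (wval w a \<sigma>)"
| "rval w (Real i) \<sigma> = reals \<sigma> i"
| "rval w (RAdd a b) \<sigma> = rval w a \<sigma> + rval w b \<sigma>"
| "rval w (RSub a b) \<sigma> = rval w a \<sigma> - rval w b \<sigma>"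
| "rval w (RMul a b) \<sigma> = rval w a \<sigma> * rval w b \<sigma>"
| "rval w (RDiv a b) \<sigma> = rval w a \<sigma> / rval w b \<sigma>"
| "rval w (RLn a) \<sigma> = ln (rval w a \<sigma>)"

text \<open>
  The second component of a configuration is the time spent so far. Every assignment, every
  draw and every evaluation of a test takes one unit: the expressions in a fixed program have
  constant size, so this agrees with the cost of the individual operations up to a constant
  factor. A run that does not halt contributes to the deficiency of the \<open>spmf\<close>.
\<close>
partial_function (spmf) timed_loop ::
    "('s \<Rightarrow> bool) \<Rightarrow> ('s \<times> nat \<Rightarrow> ('s \<times> nat) spmf) \<Rightarrow> 's \<times> nat \<Rightarrow> ('s \<times> nat) spmf" where
  "timed_loop t f cf =
     (if t (fst cf) then bind_spmf (f (fst cf, snd cf + 1)) (timed_loop t f)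
      else return_spmf (fst cf, snd cf + 1))"

primrec exec :: "nat \<Rightarrow> 'a list \<Rightarrow> 'a list \<Rightarrow> com \<Rightarrow> store \<times> nat \<Rightarrow> (store \<times> nat) spmf" where
  "exec w X Y (SetWord i a) = (\<lambda>(\<sigma>, \<tau>).
     return_spmf (\<sigma>\<lparr>words := (words \<sigma>)(i := wval w a \<sigma>)\<rparr>, \<tau> + 1))"
| "exec w X Y (SetReal i a) = (\<lambda>(\<sigma>, \<tau>).
     return_spmf (\<sigma>\<lparr>reals := (reals \<sigma>)(i := rval w a \<sigma>)\<rparr>, \<tau> + 1))"
| "exec w X Y (Flip i a) = (\<lambda>(\<sigma>, \<tau>).
     map_spmf (\<lambda>b. (\<sigma>\<lparr>words := (words \<sigma>)(i := of_bool b)\<rparr>, \<tau> + 1))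
       (spmf_of_pmf (bernoulli_pmf (rval w a \<sigma>))))"
| "exec w X Y (Seq c d) = (\<lambda>cf. bind_spmf (exec w X Y c cf) (exec w X Y d))"
| "exec w X Y (If t c d) = (\<lambda>(\<sigma>, \<tau>).
     if tval w X Y t \<sigma> then exec w X Y c (\<sigma>, \<tau> + 1) else exec w X Y d (\<sigma>, \<tau> + 1))"
| "exec w X Y (While t c) = timed_loop (tval w X Y t) (exec w X Y c)"

text \<open>
  The machine starts with \<open>n\<close>, \<open>p\<close>, \<open>k\<close> and the lengths of the two strings in registers
  \<open>0\<close> to \<open>4\<close>, and leaves its answer in register \<open>0\<close>.
\<close>
definition initial_store :: "nat \<Rightarrow> nat \<Rightarrow> nat \<Rightarrow> 'a list \<Rightarrow> 'a list \<Rightarrow> store" where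
  "initial_store n p k X Y =
     \<lparr>words = (\<lambda>_. 0)(0 := n, 1 := p, 2 := k, 3 := length X, 4 := length Y), reals = (\<lambda>_. 0)\<rparr>"

definition run :: "nat \<Rightarrow> com \<Rightarrow> nat \<Rightarrow> nat \<Rightarrow> nat \<Rightarrow> 'a list \<Rightarrow> 'a list \<Rightarrow> (answer \<times> nat) spmf" where
  "run w P n p k X Y =
     map_spmf (\<lambda>(\<sigma>, \<tau>). (if words \<sigma> 0 \<noteq> 0 then YES else NO, \<tau>))
       (exec w X Y P (initial_store n p k X Y, 0))"

text \<open>
  \<open>implementable_in T\<close>: one program, independent of all inputs, has exactly the output
  distribution of the procedure on every admissible input, and for every \<open>\<delta>\<close> its running time
  exceeds \<open>T n p \<delta>\<close> with probability at most \<open>\<delta>\<close>. The premise on \<open>w\<close> says that words have at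
  least a suitable constant times \<open>log (n + k)\<close> many bits.
\<close>
definition implementable_in :: "'a itself \<Rightarrow> (nat \<Rightarrow> nat \<Rightarrow> real \<Rightarrow> real) \<Rightarrow> bool" where
  "implementable_in TYPE('a) T \<longleftrightarrow>
     (\<exists>P a. \<forall>n k p w. \<forall>X Y :: 'a list.
        1 \<le> n \<and> 1 \<le> p \<and> 2 * ln (real n) \<le> real p \<and> p \<le> n \<and>
        length X \<le> n \<and> length Y \<le> n \<and> (n + k + 2) ^ a \<le> 2 ^ w \<longrightarrow>
          map_spmf fst (run w P n p k X Y) = spmf_of_pmf (walk_test n p k X Y) \<and>
          (\<forall>\<delta>. 0 < \<delta> \<and> \<delta> \<le> 1 \<longrightarrow>
             measure (measure_spmf (run w P n p k X Y)) {(ans, \<tau>). real \<tau> > T n p \<delta>} \<le> \<delta>))"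

end

theory Submission
  imports Defs
begin

text \<open>
  Completeness. Let \<open>m\<close> bound the insertion-deletion distance of the two remaining suffixes; initially
  \<open>m = 2 k\<close>. At a mismatch, an optimal alignment without substitutions deletes one of the two current
  characters, so one outcome of \<open>r\<close> lowers \<open>m\<close> by one and the other raises it by at most one, while
  unsampled steps do not raise it. Hence \<open>m\<close> is dominated by a simple random walk absorbed at \<open>0\<close>,
  and \<open>c - (L - m)\<^sup>2\<close> with \<open>L = 36 k\<close> serves as a potential: it bounds the probability
  that the final cost exceeds \<open>L\<^sup>2\<close> by \<open>1 - (34/36)\<^sup>2\<close>.

  Soundness. A final cost of at most \<open>N = 1296 k\<^sup>2\<close> together with \<open>ED \<ge> (N + 1) p\<close> forces one of at most
  \<open>N + 1\<close> phases between sampled mismatches to contain \<open>p\<close> unsampled mismatches in a row, which has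
  probability at most \<open>1 / n\<^sup>2\<close> for each phase; and \<open>N + 1 \<le> n\<close> because \<open>ED \<le> n\<close>.

  Running time. The number of unsampled steps before the next sample is geometric, and the binary
  digits of a geometric variable are independent: with \<open>\<beta> = 1 - q\<close>, digit \<open>i\<close> is set with probability
  \<open>\<beta>^(2^i) / (1 + \<beta>^(2^i))\<close>. They can be drawn from the least significant one by repeated squaring, so a
  jump costs \<open>O(log n)\<close>. The number of samples has exponential moment at most \<open>exp (4 n q)\<close>. The
  program is related to the procedure by a coupling that also tracks the time.
\<close>


section \<open>Edit distance and insertion-deletion distance\<close>

declare walk_loop.simps [simp del]

section \<open>Single edits and elementary bounds on the edit distance\<close>

lemma single_edit_Cons:
  assumes "single_edit xs ys" shows "single_edit (a # xs) (a # ys)"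
  using assms
proof cases
  case (insertion us vs b)
  then show ?thesis using single_edit.insertion[of "a # us" vs b] by simp
next
  case (deletion us b vs)
  then show ?thesis using single_edit.deletion[of "a # us" b vs] by simp
next
  case (substitution us b vs b')
  then show ?thesis using single_edit.substitution[of "a # us" b vs b'] by simp
qed

lemma relpowp_single_edit_Cons:
  "(single_edit ^^ m) xs ys \<Longrightarrow> (single_edit ^^ m) (a # xs) (a # ys)"
  by (induction m arbitrary: ys) (auto intro: single_edit_Cons)

lemma single_edit_Cons_left: "single_edit xs (a # xs)"
  using single_edit.insertion[of "[]" xs a] by simp

lemma single_edit_Cons_right: "single_edit (a # xs) xs"
  using single_edit.deletion[of "[]" a xs] by simp

lemma single_edit_Cons_Cons: "single_edit (a # xs) (b # xs)"
  using single_edit.substitution[of "[]" a xs b] by simp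

text \<open>Substitute along the common length, then insert or delete the rest. Besides bounding the
  distance, this provides the witness that gives the \<open>LEAST\<close> in
  \<open>edit_distance\<close> its meaning.\<close>

lemma relpowp_single_edit_max:
  "\<exists>m \<le> max (length xs) (length ys). (single_edit ^^ m) xs ys"
proof (induction xs ys rule: list_induct2')
  case 1
  then show ?case by auto
next
  case (2 x xs)
  have "(single_edit ^^ length zs) zs []" for zs :: "'a list"
    proof (induction zs)
    case (Cons z zs)
    then show ?case using relpowp_Suc_I2[of single_edit, OF single_edit_Cons_right] by simp
  qed simp
  from this[of "x # xs"] show ?case by (intro exI[of _ "length (x # xs)"]) simp
next
  case (3 y ys)
  have "(single_edit ^^ length zs) [] zs" for zs :: "'a list"
    by (induction zs) (auto intro: single_edit_Cons_left)
  from this[of "y # ys"] show ?case by (intro exI[of _ "length (y # ys)"]) simp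
next
  case (4 x xs y ys)
  then obtain m where m: "m \<le> max (length xs) (length ys)" "(single_edit ^^ m) xs ys" by auto
  from relpowp_single_edit_Cons[OF m(2)]
  have "(single_edit ^^ Suc m) (x # xs) (y # ys)"
    using single_edit_Cons_Cons relpowp_Suc_I2 by metis
  then show ?case using m(1) by (intro exI[of _ "Suc m"]) auto
qed

lemma relpowp_edit_distance: "(single_edit ^^ edit_distance X Y) X Y"
  using relpowp_single_edit_max[of X Y] unfolding edit_distance_def by (metis LeastI)

lemma edit_distance_le: "(single_edit ^^ m) X Y \<Longrightarrow> edit_distance X Y \<le> m"
  unfolding edit_distance_def by (rule Least_le)

lemma edit_distance_le_max: "edit_distance X Y \<le> max (length X) (length Y)"
  using relpowp_single_edit_max[of X Y] edit_distance_le order_trans by blast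

lemma edit_distance_Cons_same_le: "edit_distance (a # xs) (a # ys) \<le> edit_distance xs ys"
  by (intro edit_distance_le relpowp_single_edit_Cons relpowp_edit_distance)

lemma edit_distance_Cons_Cons_le:
  "edit_distance (a # xs) (b # ys) \<le> Suc (edit_distance xs ys)"
  by (intro edit_distance_le relpowp_Suc_I2[of single_edit, OF single_edit_Cons_Cons[of a xs b]]
        relpowp_single_edit_Cons relpowp_edit_distance)

lemma edit_distance_Cons_left_le: "edit_distance (a # xs) ys \<le> Suc (edit_distance xs ys)"
  by (intro edit_distance_le relpowp_Suc_I2[of single_edit, OF single_edit_Cons_right] relpowp_edit_distance)

lemma edit_distance_Cons_right_le: "edit_distance xs (a # ys) \<le> Suc (edit_distance xs ys)"
  by (intro edit_distance_le relpowp_Suc_I[of _ single_edit, OF relpowp_edit_distance single_edit_Cons_left])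

section \<open>Alignments without substitutions\<close>

text \<open>The index is an upper bound on the number of insertions and deletions, not their exact
  number: \<open>nil\<close> accepts every \<open>m\<close>.\<close>

inductive indel :: "nat \<Rightarrow> 'a list \<Rightarrow> 'a list \<Rightarrow> bool" where
  nil: "indel m [] []"
| keep: "indel m xs ys \<Longrightarrow> indel m (a # xs) (a # ys)"
| del: "indel m xs ys \<Longrightarrow> indel (Suc m) (a # xs) ys"
| ins: "indel m xs ys \<Longrightarrow> indel (Suc m) xs (a # ys)"

lemma indel_Suc: "indel m xs ys \<Longrightarrow> indel (Suc m) xs ys"
  by (induction rule: indel.induct) (auto intro: indel.intros)

lemma indel_refl: "indel m xs xs"
  by (induction xs) (auto intro: indel.intros)

lemma indel_insert: "indel m xs (us @ vs) \<Longrightarrow> indel (Suc m) xs (us @ a # vs)"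
proof (induction m xs "us @ vs" arbitrary: us rule: indel.induct)
  case (nil m)
  then show ?case by (auto intro: indel.intros)
next
  case (keep m xs ys b)
  show ?case
  proof (cases us)
    case Nil
    then show ?thesis using keep by (auto intro: indel.intros)
  next
    case (Cons c us')
    then show ?thesis using keep by (auto intro: indel.intros)
  qed
next
  case (del m xs b)
  then show ?case by (auto intro: indel.intros)
next
  case (ins m xs ys b)
  show ?case
  proof (cases us)
    case Nil
    then show ?thesis using ins by (metis append_Nil indel.ins)
  next
    case (Cons c us')
    then show ?thesis using ins by (auto intro: indel.intros)
  qed
qed

text \<open>If the removed character was kept, its partner in \<open>xs\<close> becomes a deletion;
  if it was inserted, that insertion is dropped and the budget is padded.\<close>

lemma indel_delete: "indel m xs (us @ a # vs) \<Longrightarrow> indel (Suc m) xs (us @ vs)"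
proof (induction m xs "us @ a # vs" arbitrary: us rule: indel.induct)
  case (keep m xs ys b)
  show ?case
  proof (cases us)
    case Nil
    then show ?thesis using keep by (auto intro: indel.intros)
  next
    case (Cons c us')
    then show ?thesis using keep by (auto intro: indel.intros)
  qed
next
  case (del m xs b)
  then show ?case by (auto intro: indel.intros)
next
  case (ins m xs ys b)
  show ?case
  proof (cases us)
    case Nil
    then show ?thesis using ins by (auto intro: indel_Suc)
  next
    case (Cons c us')
    then show ?thesis using ins by (auto intro: indel.intros)
  qed
qed auto

text \<open>A substitution is a deletion followed by an insertion, hence the 2; the other edits need
  only 1.\<close>

lemma indel_single_edit:
  assumes "single_edit ys zs" "indel m xs ys" shows "indel (m + 2) xs zs"
  using assms
proof (cases rule: single_edit.cases)
  case (substitution us a vs b)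
  then show ?thesis using assms indel_insert[of "Suc m" xs us vs b] indel_delete[of m xs us a vs]
    by simp
qed (use assms indel_insert indel_delete indel_Suc in fastforce)+

lemma indel_relpowp: "(single_edit ^^ j) xs ys \<Longrightarrow> indel (2 * j) xs ys"
proof (induction j arbitrary: ys)
  case 0
  then show ?case by (auto intro: indel_refl)
next
  case (Suc j)
  then obtain zs where "(single_edit ^^ j) xs zs" "single_edit zs ys" by auto
  then show ?case using Suc.IH indel_single_edit[of zs ys "2 * j" xs] by simp
qed

lemma indel_edit_distance:
  assumes "edit_distance X Y \<le> k" shows "indel (2 * k) X Y"
proof -
  have "indel (2 * edit_distance X Y + j) X Y" for j
    by (induction j) (auto intro: indel_Suc indel_relpowp relpowp_edit_distance)
  from this[of "2 * k - 2 * edit_distance X Y"] show ?thesis using assms by simp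
qed

lemma indel_Nil_left: "indel m [] ys \<Longrightarrow> length ys \<le> m"
  by (induction m "[] :: 'a list" ys rule: indel.induct) auto

lemma indel_Nil_right: "indel m xs [] \<Longrightarrow> length xs \<le> m"
  by (induction m xs "[] :: 'a list" rule: indel.induct) auto

lemma indel_commute: "indel m xs ys \<Longrightarrow> indel m ys xs"
  by (induction rule: indel.induct) (auto intro: indel.intros)

text \<open>An alignment that does not keep the two heads spends one unit on removing one of them,
  and that unit pays for removing the other as well. Thus a match does not raise the budget.\<close>

lemma indel_Cons_same:
  assumes "indel m (a # xs) (a # ys)" shows "indel m xs ys"
proof -
  have tl_right: "indel (Suc j) us vs" if "indel j us (a # vs)" for j us vs
    using indel_delete[of j us "[]" a vs] that by simp
  from assms show ?thesis
    by (cases rule: indel.cases) (auto intro: tl_right indel_commute[OF tl_right[OF indel_commute]])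
qed

text \<open>Different heads exclude \<open>keep\<close>. This is the reason why one of the two
  outcomes of \<open>r\<close> lowers the budget.\<close>

lemma indel_Cons_diff:
  "indel m (a # xs) (b # ys) \<Longrightarrow> a \<noteq> b \<Longrightarrow>
    \<exists>j. m = Suc j \<and> (indel j xs (b # ys) \<or> indel j (a # xs) ys)"
  by (cases rule: indel.cases) auto

lemma indel_Cons_leftD: "indel m (a # xs) ys \<Longrightarrow> indel (Suc m) xs ys"
  using indel_delete[of m ys "[]" a xs] indel_commute[of m "a # xs" ys] indel_commute by force

lemma indel_Cons_rightD: "indel m xs (a # ys) \<Longrightarrow> indel (Suc m) xs ys"
  using indel_delete[of m xs "[]" a ys] by simp

section \<open>Correctness of the procedure\<close>

lemma prob_bind_bernoulli_pmf:
  assumes "0 \<le> q" "q \<le> 1"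
  shows "measure_pmf.prob (bind_pmf (bernoulli_pmf q) f) A =
    q * measure_pmf.prob (f True) A + (1 - q) * measure_pmf.prob (f False) A"
proof -
  have "ennreal (measure_pmf.prob (bind_pmf (bernoulli_pmf q) f) A) =
      ennreal (q * measure_pmf.prob (f True) A + (1 - q) * measure_pmf.prob (f False) A)"
    using assms by (simp flip: measure_pmf.emeasure_eq_measure ennreal_mult' add: mult.commute)
      (simp add: measure_pmf.emeasure_eq_measure ennreal_mult'' ennreal_plus mult.commute)
  then show ?thesis using assms by (subst (asm) ennreal_inj) auto
qed

lemma walk_loop_end:
  "\<not> (x < length X \<and> y < length Y) \<Longrightarrow> walk_loop q X Y x y c = return_pmf (x, y, c)"
  by (subst walk_loop.simps) (simp only: if_False)

lemma walk_loop_match: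
  "x < length X \<Longrightarrow> y < length Y \<Longrightarrow> X ! x = Y ! y \<Longrightarrow>
    walk_loop q X Y x y c = walk_loop q X Y (x + 1) (y + 1) c"
  by (subst walk_loop.simps) simp

lemma prob_walk_loop_mismatch:
  assumes "0 \<le> q" "q \<le> 1" "x < length X" "y < length Y" "X ! x \<noteq> Y ! y"
  shows "measure_pmf.prob (walk_loop q X Y x y c) A =
    q * ((measure_pmf.prob (walk_loop q X Y (x + 1) y (c + 1)) A +
          measure_pmf.prob (walk_loop q X Y x (y + 1) (c + 1)) A) / 2) +
    (1 - q) * measure_pmf.prob (walk_loop q X Y (x + 1) (y + 1) c) A"
  using assms by (subst walk_loop.simps) (simp add: prob_bind_bernoulli_pmf field_simps)

definition cost :: "'a list \<Rightarrow> 'a list \<Rightarrow> nat \<times> nat \<times> nat \<Rightarrow> nat" where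
  "cost X Y = (\<lambda>(x, y, c). c + max (length X - x) (length Y - y))"

text \<open>The loop never lowers \<open>c\<close>. In the soundness induction, this makes a sampled
  mismatch fatal once the budget is 0.\<close>

lemma walk_loop_cost_ge: "z \<in> set_pmf (walk_loop q X Y x y c) \<Longrightarrow> c \<le> cost X Y z"
proof (induction "(length X - x) + (length Y - y)" arbitrary: x y c rule: less_induct)
  case less
  show ?case
  proof (cases "x < length X \<and> y < length Y")
    case True
    with less.prems consider "z \<in> set_pmf (walk_loop q X Y (x + 1) (y + 1) c)"
      | "z \<in> set_pmf (walk_loop q X Y (x + 1) y (c + 1))"
      | "z \<in> set_pmf (walk_loop q X Y x (y + 1) (c + 1))"
      by (subst (asm) walk_loop.simps) (auto split: if_splits simp: of_bool_def)
    moreover have "(length X - (x + 1)) + (length Y - (y + 1)) < (length X - x) + (length Y - y)"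
      "(length X - (x + 1)) + (length Y - y) < (length X - x) + (length Y - y)"
      "(length X - x) + (length Y - (y + 1)) < (length X - x) + (length Y - y)"
      using True by auto
    ultimately show ?thesis
      using less.hyps[of "x + 1" "y + 1" c] less.hyps[of "x + 1" y "c + 1"]
        less.hyps[of x "y + 1" "c + 1"] by cases linarith+
  next
    case False
    then show ?thesis using less.prems by (auto simp: walk_loop_end cost_def)
  qed
qed

section \<open>Completeness: the random walk of the insertion-deletion budget\<close>

text \<open>
  The subtraction \<open>L - m\<close> is truncated, so that for \<open>m \<ge> L\<close> the bound is at least \<open>1\<close>.
\<close>
lemma prob_walk_loop_cost_gt:
  assumes "0 \<le> q" "q \<le> 1" "0 < L"
  shows "indel m (drop x X) (drop y Y) \<Longrightarrow>
    measure_pmf.prob (walk_loop q X Y x y c) {z. L\<^sup>2 < cost X Y z} \<le>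
      1 + (real c - (real (L - m))\<^sup>2) / (real L)\<^sup>2"
proof (induction "(length X - x) + (length Y - y)" arbitrary: x y c m rule: less_induct)
  case less
  let ?P = "\<lambda>x y c. measure_pmf.prob (walk_loop q X Y x y c) {z. L\<^sup>2 < cost X Y z}"
  let ?\<Psi> = "\<lambda>m c. 1 + (real c - (real (L - m))\<^sup>2) / (real L)\<^sup>2"
  consider (out) "L \<le> m"
    | (stop) "m < L" "\<not> (x < length X \<and> y < length Y)"
    | (match) "x < length X" "y < length Y" "X ! x = Y ! y"
    | (mismatch) "m < L" "x < length X" "y < length Y" "X ! x \<noteq> Y ! y"
    by linarith
  then show ?case
  proof cases
    case out
    then have "1 \<le> ?\<Psi> m c" by simp
    then show ?thesis using measure_pmf.prob_le_1 order_trans by blast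
  next
    case stop
    \<comment> \<open>One suffix is empty, so the budget bounds the length of the other.\<close>
    have "max (length X - x) (length Y - y) \<le> m"
    proof (cases "x < length X")
      case True
      then show ?thesis using stop indel_Nil_right[of m "drop x X"] less.prems by simp
    next
      case False
      then show ?thesis using indel_Nil_left[of m "drop y Y"] less.prems by simp
    qed
    then have le: "cost X Y (x, y, c) \<le> c + m" by (simp add: cost_def)
    have "(real (L - m))\<^sup>2 \<le> (real L)\<^sup>2" by (intro power_mono) auto
    then have "0 \<le> ?\<Psi> m c"
      using assms by (simp add: field_simps add_increasing)
    \<comment> \<open>With \<open>d = L - m \<ge> 1\<close>, the square of \<open>L\<close> is at
      least \<open>d\<^sup>2 + m\<close>. Hence a cost bound \<open>c + m\<close> above
      \<open>L\<^sup>2\<close> forces \<open>c \<ge> d\<^sup>2\<close>, and the potential is at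
      least 1.\<close>
    moreover have "1 \<le> ?\<Psi> m c" if "L\<^sup>2 < c + m"
    proof -
      obtain d where d: "L = m + d" "d > 0" using stop by (metis less_imp_add_positive)
      have "real m * 1 \<le> real m * real d" using d by (intro mult_left_mono) auto
      moreover have "(real L)\<^sup>2 = (real (L - m))\<^sup>2 + (real m)\<^sup>2 + 2 * (real m * real d)"
        using d by (simp add: power2_eq_square algebra_simps)
      moreover have "0 \<le> (real m)\<^sup>2" by simp
      ultimately have "(real (L - m))\<^sup>2 + real m \<le> (real L)\<^sup>2" by linarith
      moreover have "(real L)\<^sup>2 \<le> real c + real m" using that
        by (metis nat_less_le of_nat_add of_nat_mono of_nat_power)
      ultimately have "(real (L - m))\<^sup>2 \<le> real c" by linarith
      then show ?thesis by simp
    qed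
    ultimately show ?thesis using stop le by (auto simp: walk_loop_end indicator_def)
  next
    case match
    then have "indel m (drop (x + 1) X) (drop (y + 1) Y)"
      using less.prems indel_Cons_same by (simp flip: Cons_nth_drop_Suc)
    then show ?thesis using less.hyps[of "x + 1" "y + 1" m c] match by (simp add: walk_loop_match)
  next
    case mismatch
    from less.prems mismatch
    have m: "indel m (X ! x # drop (x + 1) X) (Y ! y # drop (y + 1) Y)"
      by (simp flip: Cons_nth_drop_Suc)
    from indel_Cons_diff[OF m mismatch(4)] obtain j where j: "m = Suc j"
      "indel j (drop (x + 1) X) (drop y Y) \<or> indel j (drop x X) (drop (y + 1) Y)"
      using mismatch by (auto simp flip: Cons_nth_drop_Suc)
    have up: "indel (m + 1) (drop (x + 1) X) (drop y Y)" "indel (m + 1) (drop x X) (drop (y + 1) Y)"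
      using indel_Cons_leftD[OF m] indel_Cons_rightD[OF m] mismatch by (auto simp flip: Cons_nth_drop_Suc)
    \<comment> \<open>One of the two heads is the edit that lowers the budget to \<open>j\<close>;
      dropping the other raises it to at most \<open>m\<close> again.\<close>
    have diag: "indel m (drop (x + 1) X) (drop (y + 1) Y)"
      using j indel_Cons_leftD[of j "X ! x" "drop (x + 1) X" "drop (y + 1) Y"]
        indel_Cons_rightD[of j "drop (x + 1) X" "Y ! y" "drop (y + 1) Y"] mismatch
      by (auto simp flip: Cons_nth_drop_Suc)
    have "?P (x + 1) (y + 1) c \<le> ?\<Psi> m c"
      using less.hyps[OF _ diag] mismatch by simp
    moreover
    have lt: "(length X - (x + 1)) + (length Y - y) < (length X - x) + (length Y - y)"
      "(length X - x) + (length Y - (y + 1)) < (length X - x) + (length Y - y)"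
      using mismatch by auto
    have "?P (x + 1) y (c + 1) + ?P x (y + 1) (c + 1) \<le> ?\<Psi> j (c + 1) + ?\<Psi> (m + 1) (c + 1)"
      using j(2)
    proof
      assume "indel j (drop (x + 1) X) (drop y Y)"
      from less.hyps[OF lt(1) this, of "c + 1"] less.hyps[OF lt(2) up(2), of "c + 1"]
      show ?thesis by linarith
    next
      assume "indel j (drop x X) (drop (y + 1) Y)"
      from less.hyps[OF lt(2) this, of "c + 1"] less.hyps[OF lt(1) up(1), of "c + 1"]
      show ?thesis by linarith
    qed
    \<comment> \<open>The martingale identity: the mean of \<open>(d + 2)\<^sup>2\<close> and
      \<open>d\<^sup>2\<close> is \<open>(d + 1)\<^sup>2 + 1\<close>, and the extra 1 is offset by
      the increment of \<open>c\<close>. Since \<open>m < L\<close>, none of the three differences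
      is truncated.\<close>
    moreover have "?\<Psi> j (c + 1) + ?\<Psi> (m + 1) (c + 1) = 2 * ?\<Psi> m c"
    proof -
      obtain d where "L = m + 1 + d" using mismatch(1) by (metis Suc_eq_plus1 less_iff_Suc_add add_Suc_right add_Suc)
      then have "real (L - j) = real d + 2" "real (L - m) = real d + 1" "real (L - (m + 1)) = real d"
        using j by auto
      then have "(real (c + 1) - (real (L - j))\<^sup>2) + (real (c + 1) - (real (L - (m + 1)))\<^sup>2) =
          2 * (real c - (real (L - m))\<^sup>2)"
        by (simp add: power2_eq_square algebra_simps)
      then show ?thesis by (simp flip: add_divide_distrib)
    qed
    moreover have "q * ((a + b) / 2) + (1 - q) * d \<le> w"
      if "d \<le> w" "a + b \<le> u" "u = 2 * w" for a b d u w :: real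
    proof -
      have "q * ((a + b) / 2) + (1 - q) * d \<le> q * w + (1 - q) * w"
        using assms that by (intro add_mono mult_left_mono) auto
      then show ?thesis by (simp add: algebra_simps)
    qed
    ultimately show ?thesis unfolding prob_walk_loop_mismatch[OF assms(1,2) mismatch(2-4)] by blast
  qed
qed

lemma pmf_walk_test_YES:
  "pmf (walk_test n p k X Y) YES =
    measure_pmf.prob (walk_loop (2 * ln (real n) / real p) X Y 0 0 0) {z. cost X Y z \<le> 1296 * k\<^sup>2}"
  unfolding walk_test_def pmf_map cost_def
  by (intro arg_cong2[where f = measure]) (auto split: if_splits)

lemma pmf_walk_test_NO:
  "pmf (walk_test n p k X Y) NO = 1 - pmf (walk_test n p k X Y) YES"
proof -
  have "(UNIV :: answer set) = {YES, NO}" using answer.exhaust by auto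
  then have "(\<Sum>a\<in>{YES, NO}. pmf (walk_test n p k X Y) a) = 1"
    by (intro sum_pmf_eq_1) (auto, metis finite.emptyI finite.insertI)
  then show ?thesis by simp
qed

text \<open>Covers \<open>k = 0\<close>, where \<open>L = 36 * k\<close> would violate
  \<open>0 < L\<close> in the potential argument. The maximum accounts for a start beyond the
  end.\<close>

lemma walk_loop_same: "walk_loop q X X x x c = return_pmf (max (length X) x, max (length X) x, c)"
proof (induction "length X - x" arbitrary: x)
  case (Suc j)
  then have "x < length X" by simp
  then show ?case using Suc.hyps(1)[of "x + 1"] Suc.hyps(2) by (simp add: walk_loop_match max_def)
qed (simp add: walk_loop_end max_def)

lemma pmf_walk_test_YES_ge:
  assumes "edit_distance X Y \<le> k" "1 \<le> n" "1 \<le> p" "2 * ln (real n) \<le> real p"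
  shows "2 / 3 \<le> pmf (walk_test n p k X Y) YES"
proof (cases "k = 0")
  case True
  then have "X = Y" using assms(1) relpowp_edit_distance[of X Y] by simp
  then show ?thesis by (simp add: pmf_walk_test_YES walk_loop_same cost_def)
next
  case False
  \<comment> \<open>The square of \<open>?L\<close> is the acceptance threshold, and from the
    initial budget \<open>2 * k\<close> the ratio \<open>(L - m) / L\<close> is 34/36.\<close>
  let ?L = "36 * k" and ?q = "2 * ln (real n) / real p"
  have q: "0 \<le> ?q" "?q \<le> 1" using assms by auto
  have "measure_pmf.prob (walk_loop ?q X Y 0 0 0) {z. ?L\<^sup>2 < cost X Y z} \<le>
      1 + (real 0 - (real (?L - 2 * k))\<^sup>2) / (real ?L)\<^sup>2"
    using False assms q by (intro prob_walk_loop_cost_gt) (auto intro: indel_edit_distance)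
  also have "\<dots> = 1 - (34 / 36)\<^sup>2"
    using False by (simp add: power_mult_distrib power_divide field_simps)
  also have "\<dots> \<le> 1 / 3" by (simp add: power2_eq_square)
  finally have "measure_pmf.prob (walk_loop ?q X Y 0 0 0) {z. ?L\<^sup>2 < cost X Y z} \<le> 1 / 3" .
  moreover have "{z. ?L\<^sup>2 < cost X Y z} = UNIV - {z. cost X Y z \<le> 1296 * k\<^sup>2}"
    by (auto simp: power_mult_distrib)
  ultimately show ?thesis
    by (simp add: pmf_walk_test_YES measure_pmf.prob_compl[where A = "{z. _ z}", simplified])
qed

section \<open>Soundness: phases of unsampled mismatches\<close>

text \<open>
  Here \<open>b\<close> is the remaining budget, and \<open>t\<close> is \<open>p\<close> minus the number of unsampled mismatches since the
  last sampled one.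
\<close>
lemma prob_walk_loop_cost_le:
  assumes "0 \<le> q" "q \<le> 1" "1 \<le> p"
  shows "b * p + t \<le> edit_distance (drop x X) (drop y Y) \<Longrightarrow> t \<le> p \<Longrightarrow>
    measure_pmf.prob (walk_loop q X Y x y c) {z. cost X Y z \<le> b + c} \<le>
      (1 - q) ^ t + real b * (1 - q) ^ p"
proof (induction "(length X - x) + (length Y - y)" arbitrary: x y c b t rule: less_induct)
  case less
  let ?P = "\<lambda>x y c b. measure_pmf.prob (walk_loop q X Y x y c) {z. cost X Y z \<le> b + c}"
  let ?\<Psi> = "\<lambda>b t. (1 - q) ^ t + real b * (1 - q) ^ p"
  have nonneg: "0 \<le> ?\<Psi> b t" for b t using assms by simp
  consider (trivial) "t = 0"
    | (stop) "0 < t" "\<not> (x < length X \<and> y < length Y)"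
    | (match) "x < length X" "y < length Y" "X ! x = Y ! y"
    | (mismatch) "0 < t" "x < length X" "y < length Y" "X ! x \<noteq> Y ! y"
    by linarith
  then show ?case
  proof cases
    case trivial
    then have "1 \<le> ?\<Psi> b t" using assms by simp
    then show ?thesis using measure_pmf.prob_le_1 order_trans by blast
  next
    case stop
    \<comment> \<open>The leftover length alone already exceeds \<open>b\<close>, so the event has
      probability 0.\<close>
    have "b \<le> b * p" using assms by simp
    moreover have "b * p + t \<le> max (length X - x) (length Y - y)"
      using edit_distance_le_max[of "drop x X" "drop y Y"] less.prems by simp
    ultimately have "b < max (length X - x) (length Y - y)" using stop by linarith
    then have "\<not> cost X Y (x, y, c) \<le> b + c" by (auto simp: cost_def)
    then show ?thesis using stop nonneg[of t b] by (simp add: walk_loop_end)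
  next
    case match
    then have "edit_distance (drop x X) (drop y Y) \<le> edit_distance (drop (x + 1) X) (drop (y + 1) Y)"
      using edit_distance_Cons_same_le[of "X ! x" "drop (x + 1) X" "drop (y + 1) Y"]
      by (auto simp flip: Cons_nth_drop_Suc)
    then show ?thesis using less.hyps[of "x + 1" "y + 1" b t c] less.prems match
      by (simp add: walk_loop_match)
  next
    case mismatch
    obtain s where s: "t = Suc s" using mismatch(1) gr0_conv_Suc by auto
    let ?E = "edit_distance (drop x X) (drop y Y)"
    have E: "?E \<le> Suc (edit_distance (drop (x + 1) X) (drop (y + 1) Y))"
        "?E \<le> Suc (edit_distance (drop (x + 1) X) (drop y Y))"
        "?E \<le> Suc (edit_distance (drop x X) (drop (y + 1) Y))"
      using mismatch edit_distance_Cons_Cons_le[of "X ! x" "drop (x + 1) X" "Y ! y" "drop (y + 1) Y"]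
        edit_distance_Cons_left_le[of "X ! x" "drop (x + 1) X" "Y ! y # drop (y + 1) Y"]
        edit_distance_Cons_right_le[of "X ! x # drop (x + 1) X" "Y ! y" "drop (y + 1) Y"]
      by (auto simp flip: Cons_nth_drop_Suc)
    have diag: "?P (x + 1) (y + 1) c b \<le> ?\<Psi> b s"
      using less.hyps[of "x + 1" "y + 1" b s c] less.prems E mismatch s by simp
    \<comment> \<open>A sampled mismatch spends one unit of budget and opens a new phase with
      \<open>t = p\<close>. The distance drops by at most one, and
      \<open>b * p + t - 1 \<ge> (b - 1) * p + p\<close> because \<open>t \<ge> 1\<close>. The new
      phase contributes the summand \<open>(1 - q) ^ p\<close> that the smaller budget gives
      up.\<close>
    have side: "measure_pmf.prob (walk_loop q X Y x' y' (c + 1)) {z. cost X Y z \<le> b + c} \<le>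
        real b * (1 - q) ^ p"
      if x': "?E \<le> Suc (edit_distance (drop x' X) (drop y' Y))"
        "(length X - x') + (length Y - y') < (length X - x) + (length Y - y)" for x' y'
    proof (cases b)
      case 0
      have "c + 1 \<le> cost X Y z" if "z \<in> set_pmf (walk_loop q X Y x' y' (c + 1))" for z
        using that walk_loop_cost_ge by blast
      then have "measure_pmf.prob (walk_loop q X Y x' y' (c + 1)) {z. cost X Y z \<le> b + c} = 0"
        using 0 by (subst measure_pmf_zero_iff) fastforce
      then show ?thesis using 0 by simp
    next
      case (Suc a)
      have "a * p + p \<le> edit_distance (drop x' X) (drop y' Y)"
        using less.prems x' s Suc by simp
      from less.hyps[OF x'(2) this, of "c + 1"] show ?thesis
        using Suc by (simp add: algebra_simps)
    qed
    have "(length X - (x + 1)) + (length Y - y) < (length X - x) + (length Y - y)"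
      "(length X - x) + (length Y - (y + 1)) < (length X - x) + (length Y - y)"
      using mismatch by auto
    note sides = side[OF E(2) this(1)] side[OF E(3) this(2)]
    have "?P x y c b \<le> q * (real b * (1 - q) ^ p) + (1 - q) * ?\<Psi> b s"
      unfolding prob_walk_loop_mismatch[OF assms(1,2) mismatch(2-4)]
      using assms diag sides by (intro add_mono mult_left_mono) auto
    also have "\<dots> = ?\<Psi> b t" using s by (simp add: algebra_simps)
    finally show ?thesis .
  qed
qed

lemma pmf_walk_test_NO_ge:
  assumes "(1296 * k\<^sup>2 + 1) * p \<le> edit_distance X Y" "1 \<le> n" "1 \<le> p" "2 * ln (real n) \<le> real p"
    "length X \<le> n" "length Y \<le> n"
  shows "1 - 1 / real n \<le> pmf (walk_test n p k X Y) NO"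
proof -
  let ?N = "1296 * k\<^sup>2" and ?q = "2 * ln (real n) / real p"
  have q: "0 \<le> ?q" "?q \<le> 1" using assms by auto
  have "(?N + 1) * p \<le> n" using assms edit_distance_le_max[of X Y] by simp
  then have N: "?N + 1 \<le> n" using assms(3)
    by (metis le_trans mult.right_neutral mult_le_mono2)
  have "(1 - ?q) ^ p \<le> exp (- ?q) ^ p"
    using q exp_ge_add_one_self[of "- ?q"] by (intro power_mono) auto
  also have "\<dots> = exp (- (2 * ln (real n)))"
    using assms by (simp flip: exp_of_nat_mult)
  also have "\<dots> = 1 / (real n)\<^sup>2"
    using assms by (simp add: exp_minus exp_double field_simps)
  finally have pow: "(1 - ?q) ^ p \<le> 1 / (real n)\<^sup>2" .
  have "pmf (walk_test n p k X Y) YES \<le> (1 - ?q) ^ p + real ?N * (1 - ?q) ^ p"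
    unfolding pmf_walk_test_YES
    \<comment> \<open>Budget \<open>?N\<close> and a full first phase \<open>t = p\<close> together
      use up exactly the assumed distance.\<close>
    using prob_walk_loop_cost_le[OF q assms(3), of ?N p 0 X 0 Y 0] assms(1) by simp
  also have "\<dots> = real (?N + 1) * (1 - ?q) ^ p" by (simp add: algebra_simps)
  also have "\<dots> \<le> real n * (1 / (real n)\<^sup>2)"
    using N pow q by (intro mult_mono) (auto simp del: of_nat_add of_nat_mult of_nat_power)
  also have "\<dots> = 1 / real n" using assms by (simp add: power2_eq_square)
  finally show ?thesis by (simp add: pmf_walk_test_NO)
qed

section \<open>The number of samples\<close>

text \<open>The added \<open>m\<close> counts every draw of \<open>s = 1\<close>, also at matches,
  where \<open>c\<close> does not change: the program pays for each sample.\<close>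

function counted_walk ::
    "real \<Rightarrow> 'a list \<Rightarrow> 'a list \<Rightarrow> nat \<Rightarrow> nat \<Rightarrow> nat \<Rightarrow> nat \<Rightarrow> ((nat \<times> nat \<times> nat) \<times> nat) pmf" where
  "counted_walk q X Y x y c m =
     (if x < length X \<and> y < length Y then
        bind_pmf (bernoulli_pmf q) (\<lambda>s.
          if s then
            if X ! x \<noteq> Y ! y then
              bind_pmf (bernoulli_pmf (1/2)) (\<lambda>r.
                counted_walk q X Y (x + of_bool r) (y + (1 - of_bool r)) (c + 1) (m + 1))
            else counted_walk q X Y (x + 1) (y + 1) c (m + 1)
          else counted_walk q X Y (x + 1) (y + 1) c m)
      else return_pmf ((x, y, c), m))"
  by pat_completeness auto
termination
  by (relation "Wellfounded.measure (\<lambda>(q, X, Y, x, y, c, m). (length X - x) + (length Y - y))") auto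

declare counted_walk.simps [simp del]

text \<open>The continuation after \<open>s = 1\<close>, separated from the loop guard so that a
  jump can end in it.\<close>

definition sampled_step ::
    "real \<Rightarrow> 'a list \<Rightarrow> 'a list \<Rightarrow> nat \<Rightarrow> nat \<Rightarrow> nat \<Rightarrow> nat \<Rightarrow> ((nat \<times> nat \<times> nat) \<times> nat) pmf" where
  "sampled_step q X Y x y c m =
     (if X ! x \<noteq> Y ! y then
        bind_pmf (bernoulli_pmf (1/2)) (\<lambda>r.
          counted_walk q X Y (x + of_bool r) (y + (1 - of_bool r)) (c + 1) (m + 1))
      else counted_walk q X Y (x + 1) (y + 1) c (m + 1))"

lemma counted_walk_end:
  "\<not> (x < length X \<and> y < length Y) \<Longrightarrow> counted_walk q X Y x y c m = return_pmf ((x, y, c), m)"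
  by (subst counted_walk.simps) (simp only: if_False)

lemma counted_walk_step:
  "x < length X \<Longrightarrow> y < length Y \<Longrightarrow> counted_walk q X Y x y c m =
    bind_pmf (bernoulli_pmf q) (\<lambda>s.
      if s then sampled_step q X Y x y c m else counted_walk q X Y (x + 1) (y + 1) c m)"
  by (subst counted_walk.simps) (simp add: sampled_step_def cong: if_cong)

lemma map_fst_counted_walk: "map_pmf fst (counted_walk q X Y x y c m) = walk_loop q X Y x y c"
proof (induction "(length X - x) + (length Y - y)" arbitrary: x y c m rule: less_induct)
  case less
  show ?case
  proof (cases "x < length X \<and> y < length Y")
    case True
    then have IH: "map_pmf fst (counted_walk q X Y (x + 1) (y + 1) c m') = walk_loop q X Y (x + 1) (y + 1) c"
      "map_pmf fst (counted_walk q X Y (x + of_bool r) (y + (1 - of_bool r)) (c + 1) m') =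
        walk_loop q X Y (x + of_bool r) (y + (1 - of_bool r)) (c + 1)" for m' r
      using True by (intro less.hyps; auto simp: of_bool_def; linarith)+
    show ?thesis
      unfolding counted_walk.simps[of q X Y x y] walk_loop.simps[of q X Y x y]
      by (simp add: True map_bind_pmf IH[simplified] if_distrib[of "map_pmf fst"]
          cong: if_cong)
  next
    case False
    then show ?thesis by (simp add: counted_walk_end walk_loop_end)
  qed
qed

text \<open>An exponential-moment tail bound, proved directly by induction: each step multiplies the
  moment by at most \<open>1 + q * (exp 1 - 1) \<le> exp (2 * q)\<close> and shortens the remaining
  total length by at least one.\<close>

lemma prob_counted_walk_gt:
  assumes "0 \<le> q" "q \<le> 1"
  shows "measure_pmf.prob (counted_walk q X Y x y c m) {z. M < real (snd z)} \<le>
    exp (real m + 2 * q * real ((length X - x) + (length Y - y)) - M)"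
proof (induction "(length X - x) + (length Y - y)" arbitrary: x y c m rule: less_induct)
  case less
  let ?P = "\<lambda>x y c m. measure_pmf.prob (counted_walk q X Y x y c m) {z. M < real (snd z)}"
  let ?S = "\<lambda>x y c m. measure_pmf.prob (sampled_step q X Y x y c m) {z. M < real (snd z)}"
  show ?case
  proof (cases "x < length X \<and> y < length Y")
    case True
    define R where "R = (length X - x) + (length Y - y) - 1"
    have R: "real ((length X - x) + (length Y - y)) = real R + 1" using True by (simp add: R_def)
    have IH: "?P x' y' c' m' \<le> exp (real m' + 2 * q * real R - M)"
      if "(length X - x') + (length Y - y') \<le> R" for x' y' c' m'
    proof -
      have "?P x' y' c' m' \<le> exp (real m' + 2 * q * real ((length X - x') + (length Y - y')) - M)"
        using that True unfolding R_def by (intro less.hyps) linarith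
      also have "\<dots> \<le> exp (real m' + 2 * q * real R - M)"
        using that assms by (simp add: mult_left_mono del: of_nat_add)
      finally show ?thesis .
    qed
    have "?S x y c m \<le> exp (real (m + 1) + 2 * q * real R - M)"
    proof (cases "X ! x = Y ! y")
      case True
      then show ?thesis using IH[of "x + 1" "y + 1" c "m + 1"] \<open>x < length X \<and> y < length Y\<close>
        by (simp add: sampled_step_def R_def)
    next
      case False
      then have "?S x y c m = (?P (x + 1) y (c + 1) (m + 1) + ?P x (y + 1) (c + 1) (m + 1)) / 2"
        by (simp add: sampled_step_def prob_bind_bernoulli_pmf)
      then show ?thesis
        using IH[of "x + 1" y "c + 1" "m + 1"] IH[of x "y + 1" "c + 1" "m + 1"] True
        by (simp add: R_def)
    qed
    moreover have "?P (x + 1) (y + 1) c m \<le> exp (real m + 2 * q * real R - M)"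
      using True by (intro IH) (simp add: R_def)
    moreover have "?P x y c m = q * ?S x y c m + (1 - q) * ?P (x + 1) (y + 1) c m"
      using True assms by (simp add: counted_walk_step prob_bind_bernoulli_pmf)
    ultimately have "?P x y c m \<le> q * exp (real (m + 1) + 2 * q * real R - M) +
        (1 - q) * exp (real m + 2 * q * real R - M)"
      using assms by (auto intro!: add_mono mult_left_mono)
    also have "\<dots> = (1 + q * (exp 1 - 1)) * exp (real m + 2 * q * real R - M)"
      by (simp add: algebra_simps exp_add[of 1, symmetric] flip: exp_add)
    also have "\<dots> \<le> exp (2 * q) * exp (real m + 2 * q * real R - M)"
    proof (intro mult_right_mono)
      have "q * (exp 1 - 1) \<le> q * 2"
        using exp_le assms by (intro mult_left_mono) auto
      then show "1 + q * (exp 1 - 1) \<le> exp (2 * q)"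
        using exp_ge_add_one_self[of "2 * q"] by linarith
    qed simp
    also have "\<dots> = exp (real m + 2 * q * real ((length X - x) + (length Y - y)) - M)"
      unfolding R by (simp add: algebra_simps flip: exp_add)
    finally show ?thesis .
  next
    case False
    show ?thesis
    proof (cases "M < real m")
      case True
      then have "1 \<le> exp (real m + 2 * q * real ((length X - x) + (length Y - y)) - M)"
        using assms by (auto intro!: add_nonneg_nonneg mult_nonneg_nonneg simp: add_increasing2)
      then show ?thesis using measure_pmf.prob_le_1 order_trans by blast
    next
      case outside: False
      then show ?thesis using False by (simp add: counted_walk_end)
    qed
  qed
qed

section \<open>Geometric jumps\<close>

text \<open>The number of unsampled steps before the next sample; the value \<open>j\<close> means
  that \<open>j\<close> trials gave none.\<close>

primrec truncated_geometric :: "real \<Rightarrow> nat \<Rightarrow> nat pmf" where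
  "truncated_geometric q 0 = return_pmf 0"
| "truncated_geometric q (Suc j) =
     bind_pmf (bernoulli_pmf q) (\<lambda>s. if s then return_pmf 0 else map_pmf Suc (truncated_geometric q j))"

lemma pmf_truncated_geometric:
  assumes "0 \<le> q" "q \<le> 1"
  shows "pmf (truncated_geometric q j) i =
    (if i < j then (1 - q) ^ i * q else if i = j then (1 - q) ^ j else 0)"
proof (induction j arbitrary: i)
  case (Suc j)
  have "pmf (map_pmf Suc (truncated_geometric q j)) i =
      (case i of 0 \<Rightarrow> 0 | Suc i' \<Rightarrow> pmf (truncated_geometric q j) i')"
    by (auto simp: pmf_map_inj' pmf_map_outside split: nat.split)
  then show ?case
    using assms Suc.IH by (auto simp: pmf_bind split: nat.split)
qed (simp add: pmf_return)

text \<open>Unsampled steps follow the diagonal whatever the characters are, so only their number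
  matters up to the next sample. The cutoff is harmless once it covers the rest of the
  diagonal.\<close>

lemma counted_walk_jump:
  "min (length X - x) (length Y - y) \<le> j \<Longrightarrow>
    counted_walk q X Y x y c m = bind_pmf (truncated_geometric q j) (\<lambda>g.
      if x + g < length X \<and> y + g < length Y then sampled_step q X Y (x + g) (y + g) c m
      else return_pmf ((x + min (length X - x) (length Y - y),
        y + min (length X - x) (length Y - y), c), m))"
proof (induction j arbitrary: x y)
  case 0
  then have "\<not> (x < length X \<and> y < length Y)" by auto
  then show ?case using 0 by (auto simp: counted_walk_end bind_return_pmf)
next
  case (Suc j)
  show ?case
  proof (cases "x < length X \<and> y < length Y")
    case True
    then have "min (length X - x) (length Y - y) = Suc (min (length X - (x + 1)) (length Y - (y + 1)))"
      by auto
    then show ?thesis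
      using True Suc.prems Suc.IH[of "x + 1" "y + 1"]
      by (simp add: counted_walk_step bind_assoc_pmf bind_return_pmf bind_map_pmf if_distrib[of "\<lambda>p. bind_pmf p _"]
          cong: if_cong)
  next
    case False
    then have "min (length X - x) (length Y - y) = 0" "\<not> (x + g < length X \<and> y + g < length Y)" for g
      by auto
    then show ?thesis by (simp only: counted_walk_end[OF False] if_False bind_pmf_const add_0_right)
  qed
qed

text \<open>A geometric variable of ratio \<open>\<gamma>\<close> conditioned to lie below
  \<open>2 ^ j\<close> (uniform for \<open>\<gamma> = 1\<close>), generated from its lowest digit:
  the remaining half is again geometric, with ratio \<open>\<gamma>\<^sup>2\<close>.\<close>

primrec geometric_bits :: "nat \<Rightarrow> real \<Rightarrow> nat pmf" where
  "geometric_bits 0 \<gamma> = return_pmf 0"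
| "geometric_bits (Suc j) \<gamma> =
     bind_pmf (bernoulli_pmf (\<gamma> / (1 + \<gamma>))) (\<lambda>b. map_pmf (\<lambda>h. of_bool b + 2 * h) (geometric_bits j (\<gamma>\<^sup>2)))"

lemma set_pmf_geometric_bits: "h \<in> set_pmf (geometric_bits j \<gamma>) \<Longrightarrow> h < 2 ^ j"
proof (induction j arbitrary: h \<gamma>)
  case (Suc j)
  then obtain b h' where "h = of_bool b + 2 * h'" "h' < 2 ^ j" by auto
  then show ?case by (cases b) auto
qed simp

text \<open>
  The equation is multiplied out because the denominator vanishes for \<open>\<gamma> = 1\<close>, that is for \<open>n = 1\<close>.
\<close>
lemma pmf_geometric_bits:
  assumes "0 \<le> \<gamma>" "\<gamma> \<le> 1" "i < 2 ^ j"
  shows "pmf (geometric_bits j \<gamma>) i * (1 - \<gamma> ^ (2 ^ j)) = \<gamma> ^ i * (1 - \<gamma>)"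
  using assms
proof (induction j arbitrary: i \<gamma>)
  case (Suc j)
  let ?D = "geometric_bits j (\<gamma>\<^sup>2)"
  obtain a b where i: "i = of_bool b + 2 * a"
    by (metis (full_types) mod2_eq_if of_bool_eq mod_mult_div_eq)
  have inj: "inj (\<lambda>h. of_bool b + 2 * h :: nat)" for b by (auto intro: injI)
  have eq: "pmf (map_pmf (\<lambda>h. of_bool b' + 2 * h) ?D) i = (if b' = b then pmf ?D a else 0)" for b'
  proof (cases "b' = b")
    case True
    then show ?thesis using pmf_map_inj'[OF inj, of b ?D a] i by simp
  next
    case False
    have "i \<noteq> of_bool b' + 2 * h" for h :: nat using False i
      by (cases b; cases b') (auto, presburger+)
    then have "i \<notin> (\<lambda>h. of_bool b' + 2 * h) ` set_pmf ?D" by blast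
    then show ?thesis using False by (simp add: pmf_map_outside)
  qed
  have a: "a < 2 ^ j" using Suc.prems i by (cases b) auto
  have \<gamma>: "0 \<le> \<gamma>\<^sup>2" "\<gamma>\<^sup>2 \<le> 1" using Suc.prems by (auto intro: power_le_one)
  have "0 \<le> \<gamma> / (1 + \<gamma>)" "\<gamma> / (1 + \<gamma>) \<le> 1" using Suc.prems by auto
  note bernoulli = integral_bernoulli_pmf[OF this]
  have "1 - \<gamma> / (1 + \<gamma>) = 1 / (1 + \<gamma>)" using Suc.prems by (simp add: field_simps)
  then have "pmf (geometric_bits (Suc j) \<gamma>) i = \<gamma> ^ of_bool b / (1 + \<gamma>) * pmf ?D a"
    by (cases b) (simp_all add: pmf_bind bernoulli eq del: of_bool_eq)
  moreover have "1 - \<gamma> ^ (2 ^ Suc j) = 1 - (\<gamma>\<^sup>2) ^ (2 ^ j)" by (simp add: power_mult)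
  ultimately have "pmf (geometric_bits (Suc j) \<gamma>) i * (1 - \<gamma> ^ (2 ^ Suc j)) =
      \<gamma> ^ of_bool b / (1 + \<gamma>) * ((\<gamma>\<^sup>2) ^ a * (1 - \<gamma>\<^sup>2))"
    using Suc.IH[OF \<gamma> a] by simp
  \<comment> \<open>The factor \<open>1 + \<gamma>\<close> cancels the normalisation of the lowest
    digit.\<close>
  also have "1 - \<gamma>\<^sup>2 = (1 + \<gamma>) * (1 - \<gamma>)" by (simp add: power2_eq_square algebra_simps)
  also have "\<gamma> ^ of_bool b / (1 + \<gamma>) * ((\<gamma>\<^sup>2) ^ a * ((1 + \<gamma>) * (1 - \<gamma>))) =
      \<gamma> ^ of_bool b * (\<gamma>\<^sup>2) ^ a * (1 - \<gamma>)"
    using Suc.prems by simp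
  also have "\<gamma> ^ of_bool b * (\<gamma>\<^sup>2) ^ a = \<gamma> ^ i" by (simp add: i power_add power_mult)
  finally show ?case .
qed simp

text \<open>The bit \<open>f\<close> decides whether all \<open>2 ^ j\<close> trials fail; otherwise
  \<open>h\<close> has the conditioned law. It is drawn last because the program knows its bias only
  after the last squaring.\<close>

lemma truncated_geometric_bits:
  assumes "0 \<le> q" "q \<le> 1"
  shows "bind_pmf (geometric_bits j (1 - q)) (\<lambda>h.
      map_pmf (\<lambda>f. if f then 2 ^ j else h) (bernoulli_pmf ((1 - q) ^ (2 ^ j)))) =
    truncated_geometric q (2 ^ j)"
proof (rule pmf_eqI)
  fix i
  let ?\<rho> = "(1 - q) ^ (2 ^ j)"
  have \<rho>: "0 \<le> ?\<rho>" "?\<rho> \<le> 1" using assms by (auto intro: power_le_one)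
  have "bind_pmf (geometric_bits j (1 - q)) (\<lambda>h. map_pmf (\<lambda>f. if f then 2 ^ j else h) (bernoulli_pmf ?\<rho>)) =
      bind_pmf (bernoulli_pmf ?\<rho>) (\<lambda>f. if f then return_pmf (2 ^ j) else geometric_bits j (1 - q))"
    unfolding map_pmf_def by (subst bind_commute_pmf) (auto intro!: bind_pmf_cong simp: bind_return_pmf')
  moreover have "pmf (geometric_bits j (1 - q)) i = 0" if "\<not> i < 2 ^ j"
    using that set_pmf_geometric_bits[of i j "1 - q"] by (auto simp: pmf_eq_0_set_pmf)
  ultimately show "pmf (bind_pmf (geometric_bits j (1 - q)) (\<lambda>h.
      map_pmf (\<lambda>f. if f then 2 ^ j else h) (bernoulli_pmf ?\<rho>))) i = pmf (truncated_geometric q (2 ^ j)) i"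
    using assms \<rho> pmf_geometric_bits[of "1 - q" i j]
    by (auto simp: pmf_bind pmf_truncated_geometric mult.commute)
qed

section \<open>The program\<close>

text \<open>The right-hand side of these couplings has full mass, so a coupling also yields
  termination with probability one.\<close>

lemma rel_spmf_bind_pmfI:
  assumes "rel_spmf Q A (spmf_of_pmf p)" "\<And>a x. Q a x \<Longrightarrow> rel_spmf R (f a) (spmf_of_pmf (g x))"
  shows "rel_spmf R (bind_spmf A f) (spmf_of_pmf (bind_pmf p g))"
  using rel_spmf_bindI[OF assms(1), of R f "\<lambda>x. spmf_of_pmf (g x)"] assms(2)
  by (simp add: spmf_of_pmf_bind)

lemma rel_spmf_bind_pmf_reflI:
  assumes "\<And>x. rel_spmf R (f x) (spmf_of_pmf (g x))"
  shows "rel_spmf R (bind_pmf p f) (spmf_of_pmf (bind_pmf p g))"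
  using rel_spmf_bind_pmfI[of "(=)" "spmf_of_pmf p" p R f g] assms
  by (simp add: pmf.rel_eq)

text \<open>
  Word registers 5, 6, 7 hold \<open>x\<close>, \<open>y\<close>, \<open>c\<close>; register 8 accumulates the jump length, 9 the current
  power of two, and 10 receives the drawn bits. Real register 0 holds \<open>1 - q\<close>, and register 1 its
  iterated squares.
\<close>
definition draw_bit :: com where
  "draw_bit =
     Seq (Flip 10 (RDiv (Real 1) (RAdd (OfWord (Const 1)) (Real 1))))
     (Seq (SetWord 8 (Add (Word 8) (Mul (Word 10) (Word 9))))
     (Seq (SetWord 9 (Add (Word 9) (Word 9)))
     (SetReal 1 (RMul (Real 1) (Real 1)))))"

definition draw_bits :: com where
  "draw_bits = While (Neg (Less (Word 0) (Word 9))) draw_bit"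

text \<open>The assignment \<open>SetWord 8 (Word 8)\<close> changes nothing; it gives both branches
  the same cost, so that the time of a jump is exact.\<close>

definition draw_jump :: com where
  "draw_jump =
     Seq (SetWord 8 (Const 0))
     (Seq (SetWord 9 (Const 1))
     (Seq (SetReal 1 (Real 0))
     (Seq draw_bits
     (Seq (Flip 10 (Real 1))
     (If (Less (Const 0) (Word 10)) (SetWord 8 (Word 9)) (SetWord 8 (Word 8)))))))"

definition advance :: com where
  "advance = Seq (SetWord 5 (Add (Word 5) (Word 8))) (SetWord 6 (Add (Word 6) (Word 8)))"

text \<open>The guard compares the jump with the remaining lengths instead of adding it to the
  positions, so no wraparound can occur there.\<close>

definition jump_step :: com where
  "jump_step =
     If (Conj (Less (Word 8) (Sub (Word 3) (Word 5))) (Less (Word 8) (Sub (Word 4) (Word 6))))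
       (Seq advance
         (If (Match (Word 5) (Word 6))
           (Seq (SetWord 5 (Add (Word 5) (Const 1))) (SetWord 6 (Add (Word 6) (Const 1))))
           (Seq (Flip 10 (RDiv (OfWord (Const 1)) (OfWord (Const 2))))
           (Seq (SetWord 5 (Add (Word 5) (Word 10)))
           (Seq (SetWord 6 (Add (Word 6) (Sub (Const 1) (Word 10))))
           (SetWord 7 (Add (Word 7) (Const 1))))))))
       (Seq (If (Less (Sub (Word 3) (Word 5)) (Sub (Word 4) (Word 6)))
              (SetWord 8 (Sub (Word 3) (Word 5)))
              (SetWord 8 (Sub (Word 4) (Word 6))))
            advance)"

definition walk_program :: com where
  "walk_program = While (Conj (Less (Word 5) (Word 3)) (Less (Word 6) (Word 4))) (Seq draw_jump jump_step)"

text \<open>When the loop ends, one of the two remaining lengths is 0, so their sum serves as their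
  maximum.\<close>

definition test_program :: com where
  "test_program =
     Seq (SetReal 0 (RSub (OfWord (Const 1))
            (RDiv (RMul (OfWord (Const 2)) (RLn (OfWord (Word 0)))) (OfWord (Word 1)))))
     (Seq walk_program
     (If (Less (Mul (Const 1296) (Mul (Word 2) (Word 2)))
               (Add (Word 7) (Add (Sub (Word 3) (Word 5)) (Sub (Word 4) (Word 6)))))
        (SetWord 0 (Const 0)) (SetWord 0 (Const 1))))"

section \<open>Execution of a single jump\<close>

declare exec.simps(6) [simp del]

lemma exec_While_False: "\<not> tval w X Y t \<sigma> \<Longrightarrow> exec w X Y (While t c) (\<sigma>, \<tau>) = return_spmf (\<sigma>, \<tau> + 1)"
  by (simp add: exec.simps(6) timed_loop.simps)

lemma exec_While_True:
  "tval w X Y t \<sigma> \<Longrightarrow>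
    exec w X Y (While t c) (\<sigma>, \<tau>) = bind_spmf (exec w X Y c (\<sigma>, \<tau> + 1)) (exec w X Y (While t c))"
  unfolding exec.simps(6) by (subst timed_loop.simps) simp

definition agree_outside :: "nat set \<Rightarrow> store \<Rightarrow> store \<Rightarrow> bool" where
  "agree_outside S \<sigma> \<sigma>' \<longleftrightarrow> (\<forall>i. i \<notin> S \<longrightarrow> words \<sigma>' i = words \<sigma> i) \<and> reals \<sigma>' 0 = reals \<sigma> 0"

text \<open>The hypotheses make \<open>j\<close> the exact number of remaining rounds: register 9
  first exceeds register 0 after \<open>j\<close> doublings. A round costs four instructions and a
  test, and the failing test adds one. Register 8 stays below register 9, so no sum wraps
  around.\<close>

lemma exec_draw_bits:
  assumes "words \<sigma> 8 < words \<sigma> 9" "words \<sigma> 0 < words \<sigma> 9 * 2 ^ j" "0 < j \<Longrightarrow> words \<sigma> 9 * 2 ^ (j - 1) \<le> words \<sigma> 0"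
    "2 * words \<sigma> 0 < 2 ^ w" "0 < w"
  shows "rel_spmf (\<lambda>(\<sigma>', \<tau>') h. words \<sigma>' 8 = words \<sigma> 8 + words \<sigma> 9 * h \<and>
        words \<sigma>' 9 = words \<sigma> 9 * 2 ^ j \<and> reals \<sigma>' 1 = reals \<sigma> 1 ^ (2 ^ j) \<and>
        agree_outside {8, 9, 10} \<sigma> \<sigma>' \<and> \<tau>' = \<tau> + 5 * j + 1)
      (exec w X Y draw_bits (\<sigma>, \<tau>)) (spmf_of_pmf (geometric_bits j (reals \<sigma> 1)))"
  using assms
proof (induction j arbitrary: \<sigma> \<tau>)
  case 0
  then show ?case by (simp add: draw_bits_def exec_While_False agree_outside_def)
next
  case (Suc j)
  let ?g = "words \<sigma> 8" and ?u = "words \<sigma> 9" and ?r = "reals \<sigma> 1"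
  have "?u \<le> ?u * 2 ^ j" by simp
  also have "\<dots> \<le> words \<sigma> 0" using Suc.prems(3) by simp
  finally have u: "?u \<le> words \<sigma> 0" .
  define next_store where "next_store b = \<sigma>\<lparr>words := (words \<sigma>)(10 := of_bool b,
      8 := ?g + of_bool b * ?u, 9 := 2 * ?u), reals := (reals \<sigma>)(1 := ?r\<^sup>2)\<rparr>" for b
  have next_reals: "reals (next_store b) 1 = ?r\<^sup>2" for b by (simp add: next_store_def)
  let ?loop = "exec w X Y draw_bits"
  have mods: "(?g + of_bool b * ?u) mod 2 ^ w = ?g + of_bool b * ?u" "of_bool b * ?u mod 2 ^ w = of_bool b * ?u"
    "2 * ?u mod 2 ^ w = 2 * ?u" for b
    using Suc.prems u by (cases b; simp)+
  have five: "\<tau> + 5 = Suc (Suc (Suc (Suc (Suc \<tau>))))" by simp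
  have bit: "exec w X Y draw_bit (\<sigma>, \<tau> + 1) =
      bind_pmf (bernoulli_pmf (?r / (1 + ?r))) (\<lambda>b. return_spmf (next_store b, \<tau> + 5))"
    using Suc.prems(5) unfolding five
    by (simp add: draw_bit_def bind_map_pmf next_store_def power2_eq_square mods flip: mult_2)
  have unfold: "?loop (\<sigma>, \<tau>) = bind_pmf (bernoulli_pmf (?r / (1 + ?r))) (\<lambda>b. ?loop (next_store b, \<tau> + 5))"
    unfolding draw_bits_def using u
    by (subst exec_While_True)
      (simp, simp only: bit bind_spmf_of_pmf[symmetric] bind_spmf_assoc return_bind_spmf)
  show ?case unfolding unfold geometric_bits.simps
  proof (rule rel_spmf_bind_pmf_reflI)
    fix b
    let ?\<sigma> = "next_store b"
    have "rel_spmf (\<lambda>(\<sigma>', \<tau>') h. words \<sigma>' 8 = words ?\<sigma> 8 + words ?\<sigma> 9 * h \<and>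
        words \<sigma>' 9 = words ?\<sigma> 9 * 2 ^ j \<and> reals \<sigma>' 1 = reals ?\<sigma> 1 ^ (2 ^ j) \<and>
        agree_outside {8, 9, 10} ?\<sigma> \<sigma>' \<and> \<tau>' = \<tau> + 5 + 5 * j + 1)
      (?loop (?\<sigma>, \<tau> + 5)) (spmf_of_pmf (geometric_bits j (reals ?\<sigma> 1)))"
    proof (rule Suc.IH)
      show "words ?\<sigma> 9 * 2 ^ (j - 1) \<le> words ?\<sigma> 0" if "0 < j"
        using that Suc.prems(3) by (cases j) (auto simp: next_store_def)
    qed (use Suc.prems in \<open>auto simp: next_store_def\<close>)
    then show "rel_spmf (\<lambda>(\<sigma>', \<tau>') h. words \<sigma>' 8 = ?g + ?u * h \<and> words \<sigma>' 9 = ?u * 2 ^ Suc j \<and>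
        reals \<sigma>' 1 = ?r ^ (2 ^ Suc j) \<and> agree_outside {8, 9, 10} \<sigma> \<sigma>' \<and> \<tau>' = \<tau> + 5 * Suc j + 1)
      (?loop (?\<sigma>, \<tau> + 5)) (spmf_of_pmf (map_pmf (\<lambda>h. of_bool b + 2 * h) (geometric_bits j (?r\<^sup>2))))"
      unfolding map_spmf_of_pmf[symmetric] spmf_rel_map next_reals
      by (rule rel_spmf_mono) (auto simp: next_store_def agree_outside_def power_mult algebra_simps)
  qed
qed

text \<open>Time: three assignments, \<open>5 * l + 1\<close> for the digits, and three for the
  overriding bit.\<close>

lemma exec_draw_jump:
  assumes "0 \<le> reals \<sigma> 0" "reals \<sigma> 0 \<le> 1" "words \<sigma> 0 < 2 ^ l" "0 < l \<Longrightarrow> 2 ^ (l - 1) \<le> words \<sigma> 0"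
    "2 * words \<sigma> 0 < 2 ^ w" "0 < w"
  shows "rel_spmf (\<lambda>(\<sigma>', \<tau>') g. words \<sigma>' 8 = g \<and> agree_outside {8, 9, 10} \<sigma> \<sigma>' \<and> \<tau>' = \<tau> + 5 * l + 7)
      (exec w X Y draw_jump (\<sigma>, \<tau>)) (spmf_of_pmf (truncated_geometric (1 - reals \<sigma> 0) (2 ^ l)))"
proof -
  define \<sigma>\<^sub>1 where "\<sigma>\<^sub>1 = \<sigma>\<lparr>words := (words \<sigma>)(8 := 0, 9 := 1), reals := (reals \<sigma>)(1 := reals \<sigma> 0)\<rparr>"
  let ?rest = "Seq (Flip 10 (Real 1)) (If (Less (Const 0) (Word 10)) (SetWord 8 (Word 9)) (SetWord 8 (Word 8)))"
  have start: "exec w X Y draw_jump (\<sigma>, \<tau>) = bind_spmf (exec w X Y draw_bits (\<sigma>\<^sub>1, \<tau> + 3)) (exec w X Y ?rest)"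
    using assms(6) by (simp add: draw_jump_def \<sigma>\<^sub>1_def numeral_3_eq_3)
  have rest: "exec w X Y ?rest (\<sigma>', \<tau>') = bind_pmf (bernoulli_pmf (reals \<sigma>' 1)) (\<lambda>b. return_spmf
      (\<sigma>'\<lparr>words := (words \<sigma>')(10 := of_bool b, 8 := if b then words \<sigma>' 9 else words \<sigma>' 8)\<rparr>, \<tau>' + 3))" for \<sigma>' \<tau>'
  proof -
    have "(words \<sigma>')(10 := 0, 8 := words \<sigma>' 8) = (words \<sigma>')(10 := 0)" by auto
    then show ?thesis
      by (simp add: bind_map_pmf numeral_3_eq_3) (intro bind_pmf_cong refl, simp)
  qed
  have law: "truncated_geometric (1 - reals \<sigma> 0) (2 ^ l) = bind_pmf (geometric_bits l (reals \<sigma>\<^sub>1 1)) (\<lambda>h.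
      bind_pmf (bernoulli_pmf (reals \<sigma> 0 ^ (2 ^ l))) (\<lambda>b. return_pmf (if b then 2 ^ l else h)))"
    using truncated_geometric_bits[of "1 - reals \<sigma> 0" l] assms by (simp add: map_pmf_def \<sigma>\<^sub>1_def)
  show ?thesis unfolding start law
  proof (rule rel_spmf_bind_pmfI[OF exec_draw_bits], goal_cases)
    case (6 a h)
    obtain \<sigma>' \<tau>' where a: "a = (\<sigma>', \<tau>')" by (cases a)
    have "words \<sigma>' 8 = h" "words \<sigma>' 9 = 2 ^ l" "reals \<sigma>' 1 = reals \<sigma> 0 ^ (2 ^ l)" "agree_outside {8, 9, 10} \<sigma> \<sigma>'"
      "\<tau>' = \<tau> + 5 * l + 4"
      using 6 by (auto simp: a \<sigma>\<^sub>1_def agree_outside_def)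
    then show ?case unfolding a rest
      by (simp only: if_True) (intro rel_spmf_bind_pmf_reflI, auto simp: agree_outside_def)
  qed (use assms in \<open>auto simp: \<sigma>\<^sub>1_def\<close>)
qed

section \<open>Coupling of the program with the counted walk\<close>

text \<open>Each increment of \<open>c\<close> comes with the advance of a coordinate; the resulting
  bound \<open>c \<le> x + y\<close> keeps register 7 from wrapping around.\<close>

definition walk_state :: "nat \<Rightarrow> nat \<Rightarrow> real \<Rightarrow> 'a list \<Rightarrow> 'a list \<Rightarrow> nat \<times> nat \<times> nat \<Rightarrow> store \<Rightarrow> bool" where
  "walk_state n k q X Y = (\<lambda>(x, y, c) \<sigma>.
     words \<sigma> 0 = n \<and> words \<sigma> 2 = k \<and> words \<sigma> 3 = length X \<and> words \<sigma> 4 = length Y \<and>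
     words \<sigma> 5 = x \<and> words \<sigma> 6 = y \<and> words \<sigma> 7 = c \<and> reals \<sigma> 0 = 1 - q \<and>
     x \<le> length X \<and> y \<le> length Y \<and> c \<le> x + y)"

lemma walk_state_agree:
  "walk_state n k q X Y z \<sigma> \<Longrightarrow> agree_outside {8, 9, 10} \<sigma> \<sigma>' \<Longrightarrow> walk_state n k q X Y z \<sigma>'"
  by (auto simp: walk_state_def agree_outside_def)

lemma exec_jump_step_end:
  assumes "walk_state n k q X Y (x, y, c) \<sigma>" "\<not> (x + words \<sigma> 8 < length X \<and> y + words \<sigma> 8 < length Y)"
    "length X < 2 ^ w" "length Y < 2 ^ w"
  shows "\<exists>\<sigma>'. exec w X Y jump_step (\<sigma>, \<tau>) = return_spmf (\<sigma>', \<tau> + 5) \<and>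
    walk_state n k q X Y (x + min (length X - x) (length Y - y), y + min (length X - x) (length Y - y), c) \<sigma>'"
proof -
  let ?d = "min (length X - x) (length Y - y)"
  let ?\<sigma>' = "\<sigma>\<lparr>words := (words \<sigma>)(8 := ?d, 5 := x + ?d, 6 := y + ?d)\<rparr>"
  have \<sigma>: "words \<sigma> 3 = length X" "words \<sigma> 4 = length Y" "words \<sigma> 5 = x" "words \<sigma> 6 = y"
    "x \<le> length X" "y \<le> length Y"
    using assms(1) by (auto simp: walk_state_def)
  have "x + ?d \<le> length X" "y + ?d \<le> length Y" using \<sigma>(5,6) by auto
  then have mods: "(x + ?d) mod 2 ^ w = x + ?d" "(y + ?d) mod 2 ^ w = y + ?d"
    using assms(3,4) by (simp_all only: mod_less le_less_trans)
  have "\<not> (words \<sigma> 8 < length X - x \<and> words \<sigma> 8 < length Y - y)" using assms(2) by linarith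
  moreover have "exec w X Y (Seq (If (Less (Sub (Word 3) (Word 5)) (Sub (Word 4) (Word 6)))
              (SetWord 8 (Sub (Word 3) (Word 5)))
              (SetWord 8 (Sub (Word 4) (Word 6))))
            advance) (\<sigma>, Suc \<tau>) = return_spmf (?\<sigma>', \<tau> + 5)"
  proof (cases "length X - x < length Y - y")
    case True
    then have "?d = length X - x" by simp
    then show ?thesis using True mods by (simp only:) (simp add: \<sigma> advance_def)
  next
    case False
    then have "?d = length Y - y" by simp
    then show ?thesis using False mods by (simp only:) (simp add: \<sigma> advance_def)
  qed
  ultimately have "exec w X Y jump_step (\<sigma>, \<tau>) = return_spmf (?\<sigma>', \<tau> + 5)"
    by (auto simp: jump_step_def \<sigma>(1-4) simp del: exec.simps(4))
  moreover have "walk_state n k q X Y (x + ?d, y + ?d, c) ?\<sigma>'"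
    using assms(1) by (auto simp: walk_state_def)
  ultimately show ?thesis by blast
qed

lemma exec_jump_step_match:
  assumes "walk_state n k q X Y (x, y, c) \<sigma>" "x + words \<sigma> 8 < length X" "y + words \<sigma> 8 < length Y"
    "length X < 2 ^ w" "length Y < 2 ^ w" "0 < w" "X ! (x + words \<sigma> 8) = Y ! (y + words \<sigma> 8)"
  shows "\<exists>\<sigma>'. exec w X Y jump_step (\<sigma>, \<tau>) = return_spmf (\<sigma>', \<tau> + 6) \<and>
    walk_state n k q X Y (x + words \<sigma> 8 + 1, y + words \<sigma> 8 + 1, c) \<sigma>'"
  using assms by (auto simp: walk_state_def jump_step_def advance_def)

lemma exec_jump_step_mismatch:
  assumes "walk_state n k q X Y (x, y, c) \<sigma>" "x + words \<sigma> 8 < length X" "y + words \<sigma> 8 < length Y"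
    "length X + length Y < 2 ^ w" "2 < (2::nat) ^ w" "X ! (x + words \<sigma> 8) \<noteq> Y ! (y + words \<sigma> 8)"
  shows "\<exists>\<sigma>'. exec w X Y jump_step (\<sigma>, \<tau>) =
      bind_pmf (bernoulli_pmf (1 / 2)) (\<lambda>r. return_spmf (\<sigma>' r, \<tau> + 8)) \<and>
    (\<forall>r. walk_state n k q X Y (x + words \<sigma> 8 + of_bool r, y + words \<sigma> 8 + (1 - of_bool r), c + 1) (\<sigma>' r))"
proof -
  let ?x = "x + words \<sigma> 8" and ?y = "y + words \<sigma> 8"
  let ?\<sigma>' = "\<lambda>r. \<sigma>\<lparr>words := (words \<sigma>)(5 := ?x, 6 := ?y, 10 := of_bool r,
    5 := ?x + of_bool r, 6 := ?y + (1 - of_bool r), 7 := c + 1)\<rparr>"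
  have \<sigma>: "words \<sigma> 3 = length X" "words \<sigma> 4 = length Y" "words \<sigma> 5 = x" "words \<sigma> 6 = y" "words \<sigma> 7 = c"
    "c \<le> x + y"
    using assms(1) by (auto simp: walk_state_def)
  have "0 < w" using assms(5) by (cases w) auto
  then have mods: "?x mod 2 ^ w = ?x" "?y mod 2 ^ w = ?y" "(c + 1) mod 2 ^ w = c + 1" "1 mod 2 ^ w = (1::nat)"
    "2 mod 2 ^ w = (2::nat)"
    "(of_bool r + ?x) mod 2 ^ w = of_bool r + ?x" "(?y + (1 - of_bool r)) mod 2 ^ w = ?y + (1 - of_bool r)" for r
    using assms \<sigma>(6) by (auto intro!: mod_less simp: of_bool_def)
  have eight: "\<tau> + 8 = \<tau> + 1 + 1 + 1 + 1 + 1 + 1 + 1 + 1" by simp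
  have "exec w X Y jump_step (\<sigma>, \<tau>) =
      bind_pmf (bernoulli_pmf (1 / 2)) (\<lambda>r. return_spmf (?\<sigma>' r, \<tau> + 8))"
    unfolding eight using assms(2,3,6)
    by (simp add: jump_step_def advance_def \<sigma> mods[simplified] less_diff_conv add.commute bind_map_pmf)
  moreover have "walk_state n k q X Y (?x + of_bool r, ?y + (1 - of_bool r), c + 1) (?\<sigma>' r)" for r
    using assms by (cases r) (auto simp: walk_state_def)
  ultimately show ?thesis by (intro exI[of _ ?\<sigma>'] conjI allI)
qed

text \<open>A round costs at most \<open>5 * l + 16\<close>: one for the guard,
  \<open>5 * l + 7\<close> for the jump, at most 8 for the step. Every round but a last one that
  leaves the strings contains a sample, hence \<open>m' + 1\<close>; the final 1 is the failing
  guard. The time bound is additive to avoid subtraction of naturals.\<close>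

lemma exec_walk_program:
  assumes q: "0 \<le> q" "q \<le> 1" and l: "n < 2 ^ l" "0 < l \<Longrightarrow> 2 ^ (l - 1) \<le> n"
    and w: "2 * n < 2 ^ w" "2 < (2::nat) ^ w" and len: "length X \<le> n" "length Y \<le> n"
  shows "walk_state n k q X Y (x, y, c) \<sigma> \<Longrightarrow>
    rel_spmf (\<lambda>(\<sigma>', \<tau>') (z, m'). walk_state n k q X Y z \<sigma>' \<and>
        (fst z = length X \<or> fst (snd z) = length Y) \<and>
        \<tau>' + (5 * l + 16) * m \<le> \<tau> + (5 * l + 16) * (m' + 1) + 1)
      (exec w X Y walk_program (\<sigma>, \<tau>)) (spmf_of_pmf (counted_walk q X Y x y c m))"
proof (induction "(length X - x) + (length Y - y)" arbitrary: x y c m \<sigma> \<tau> rule: less_induct)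
  case less
  let ?K = "5 * l + 16" and ?loop = "exec w X Y walk_program"
  let ?R = "\<lambda>m \<tau> (\<sigma>', \<tau>') (z, m'). walk_state n k q X Y z \<sigma>' \<and>
        (fst z = length X \<or> fst (snd z) = length Y) \<and> \<tau>' + ?K * m \<le> \<tau> + ?K * (m' + 1) + 1"
  have w0: "0 < w" using w(2) by (cases w) auto
  have bounds: "length X < 2 ^ w" "length Y < 2 ^ w" "length X + length Y < 2 ^ w"
    using w(1) len by linarith+
  have stop: "?loop (\<sigma>, \<tau>) = return_spmf (\<sigma>, \<tau> + 1)"
    if "walk_state n k q X Y (x, y, c) \<sigma>" "\<not> (x < length X \<and> y < length Y)" for \<sigma> \<tau> x y c
    unfolding walk_program_def using that by (subst exec_While_False) (auto simp: walk_state_def)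
  show ?case
  proof (cases "x < length X \<and> y < length Y")
    case False
    with less.prems have "x = length X \<or> y = length Y" by (auto simp: walk_state_def)
    then show ?thesis using less.prems False
      by (simp add: stop counted_walk_end)
  next
    case True
    have unfold: "?loop (\<sigma>, \<tau>) =
        bind_spmf (exec w X Y draw_jump (\<sigma>, \<tau> + 1)) (\<lambda>cf. bind_spmf (exec w X Y jump_step cf) ?loop)"
      unfolding walk_program_def using True less.prems
      by (subst exec_While_True) (simp_all add: walk_state_def)
    have jump: "counted_walk q X Y x y c m = bind_pmf (truncated_geometric (1 - reals \<sigma> 0) (2 ^ l)) (\<lambda>g.
      if x + g < length X \<and> y + g < length Y then sampled_step q X Y (x + g) (y + g) c m
      else return_pmf ((x + min (length X - x) (length Y - y),
        y + min (length X - x) (length Y - y), c), m))"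
      using less.prems len l(1) counted_walk_jump[of X x Y y "2 ^ l" q c m] by (simp add: walk_state_def)
    show ?thesis unfolding unfold jump
    proof (rule rel_spmf_bind_pmfI[OF exec_draw_jump], goal_cases)
      case (7 a g)
      obtain \<sigma>' \<tau>' where a: "a = (\<sigma>', \<tau>')" by (cases a)
      have g: "words \<sigma>' 8 = g" and \<tau>': "\<tau>' = \<tau> + 5 * l + 8" and \<sigma>': "walk_state n k q X Y (x, y, c) \<sigma>'"
        using 7 walk_state_agree[OF less.prems] by (auto simp: a)
      consider (finish) "\<not> (x + g < length X \<and> y + g < length Y)"
        | (match) "x + g < length X" "y + g < length Y" "X ! (x + g) = Y ! (y + g)"
        | (mismatch) "x + g < length X" "y + g < length Y" "X ! (x + g) \<noteq> Y ! (y + g)"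
        by blast
      then show ?case
      proof cases
        case finish
        let ?d = "min (length X - x) (length Y - y)"
        obtain \<sigma>'' where \<sigma>'': "exec w X Y jump_step (\<sigma>', \<tau>') = return_spmf (\<sigma>'', \<tau>' + 5)"
          "walk_state n k q X Y (x + ?d, y + ?d, c) \<sigma>''"
          using exec_jump_step_end[OF \<sigma>'] finish bounds unfolding g by blast
        have "x + ?d = length X \<or> y + ?d = length Y" using True by auto
        then have "?loop (\<sigma>'', \<tau>' + 5) = return_spmf (\<sigma>'', \<tau>' + 5 + 1)"
          by (intro stop[OF \<sigma>''(2)]) auto
        then show ?thesis
          using \<sigma>'' finish \<open>x + ?d = length X \<or> y + ?d = length Y\<close> by (auto simp: a \<tau>')
      next
        case match
        obtain \<sigma>'' where \<sigma>'': "exec w X Y jump_step (\<sigma>', \<tau>') = return_spmf (\<sigma>'', \<tau>' + 6)"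
          "walk_state n k q X Y (x + g + 1, y + g + 1, c) \<sigma>''"
          using exec_jump_step_match[OF \<sigma>'] match bounds w0 unfolding g by blast
        have "rel_spmf (?R (m + 1) (\<tau>' + 6)) (?loop (\<sigma>'', \<tau>' + 6))
            (spmf_of_pmf (counted_walk q X Y (x + g + 1) (y + g + 1) c (m + 1)))"
          by (rule less.hyps[OF _ \<sigma>''(2)]) (use match in linarith)
        then have "rel_spmf (?R m \<tau>) (?loop (\<sigma>'', \<tau>' + 6))
            (spmf_of_pmf (counted_walk q X Y (x + g + 1) (y + g + 1) c (m + 1)))"
          by (rule rel_spmf_mono) (auto simp: \<tau>' algebra_simps)
        then show ?thesis using match \<sigma>''(1) by (simp add: a sampled_step_def)
      next
        case mismatch
        obtain \<sigma>'' where \<sigma>'': "exec w X Y jump_step (\<sigma>', \<tau>') =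
            bind_pmf (bernoulli_pmf (1 / 2)) (\<lambda>r. return_spmf (\<sigma>'' r, \<tau>' + 8))"
          "\<And>r. walk_state n k q X Y (x + g + of_bool r, y + g + (1 - of_bool r), c + 1) (\<sigma>'' r)"
          using exec_jump_step_mismatch[OF \<sigma>', of w \<tau>'] mismatch bounds w(2) unfolding g by blast
        have "rel_spmf (?R m \<tau>) (?loop (\<sigma>'' r, \<tau>' + 8))
            (spmf_of_pmf (counted_walk q X Y (x + g + of_bool r) (y + g + (1 - of_bool r)) (c + 1) (m + 1)))" for r
        proof -
          have "rel_spmf (?R (m + 1) (\<tau>' + 8)) (?loop (\<sigma>'' r, \<tau>' + 8))
            (spmf_of_pmf (counted_walk q X Y (x + g + of_bool r) (y + g + (1 - of_bool r)) (c + 1) (m + 1)))"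
            by (rule less.hyps[OF _ \<sigma>''(2)]) (use mismatch in \<open>cases r; simp; linarith\<close>)
          then show ?thesis
            by (rule rel_spmf_mono) (auto simp: \<tau>' algebra_simps)
        qed
        moreover have "bind_spmf (exec w X Y jump_step (\<sigma>', \<tau>')) ?loop =
            bind_pmf (bernoulli_pmf (1 / 2)) (\<lambda>r. ?loop (\<sigma>'' r, \<tau>' + 8))"
          unfolding \<sigma>''(1) by (simp only: bind_spmf_of_pmf[symmetric] bind_spmf_assoc return_bind_spmf)
        moreover have "(if x + g < length X \<and> y + g < length Y then sampled_step q X Y (x + g) (y + g) c m
            else return_pmf ((x + min (length X - x) (length Y - y),
              y + min (length X - x) (length Y - y), c), m)) =
            bind_pmf (bernoulli_pmf (1 / 2)) (\<lambda>r.
              counted_walk q X Y (x + g + of_bool r) (y + g + (1 - of_bool r)) (c + 1) (m + 1))"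
          using mismatch by (simp only: sampled_step_def if_True simp_thms)
        ultimately show ?thesis by (simp only: a) (rule rel_spmf_bind_pmf_reflI)
      qed
    qed (use less.prems l w w0 q in \<open>auto simp: walk_state_def\<close>)
  qed
qed

text \<open>The additive 4 covers the initial assignment, the failing loop guard, and the final test
  with its assignment.\<close>

lemma run_test_program:
  assumes n: "1 \<le> n" "1 \<le> p" "2 * ln (real n) \<le> real p" and l: "n < 2 ^ l" "0 < l \<Longrightarrow> 2 ^ (l - 1) \<le> n"
    and w: "4 * n < 2 ^ w" "1296 * k\<^sup>2 < 2 ^ w" "1296 < (2::nat) ^ w" and len: "length X \<le> n" "length Y \<le> n"
  shows "rel_spmf (\<lambda>(ans, \<tau>) (z, m). (ans = YES \<longleftrightarrow> cost X Y z \<le> 1296 * k\<^sup>2) \<and>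
        \<tau> \<le> (5 * l + 16) * (m + 1) + 4)
      (run w test_program n p k X Y)
      (spmf_of_pmf (counted_walk (2 * ln (real n) / real p) X Y 0 0 0 0))"
proof -
  let ?q = "2 * ln (real n) / real p"
  have q: "0 \<le> ?q" "?q \<le> 1" using n by auto
  define \<sigma> where "\<sigma> = (initial_store n p k X Y)\<lparr>reals := (\<lambda>_. 0)(0 := 1 - ?q)\<rparr>"
  let ?test = "If (Less (Mul (Const 1296) (Mul (Word 2) (Word 2)))
               (Add (Word 7) (Add (Sub (Word 3) (Word 5)) (Sub (Word 4) (Word 6)))))
        (SetWord 0 (Const 0)) (SetWord 0 (Const 1))"
  have w0: "0 < w" using w(3) by (cases w) auto
  then have "1 mod 2 ^ w = (1::nat)" "2 mod 2 ^ w = (2::nat)" using w(3) by (auto intro!: mod_less)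
  then have start: "exec w X Y test_program (initial_store n p k X Y, 0) =
      bind_spmf (exec w X Y walk_program (\<sigma>, 1)) (exec w X Y ?test)"
    by (simp add: test_program_def \<sigma>_def initial_store_def w0)
  have walk: "rel_spmf (\<lambda>(\<sigma>', \<tau>') (z, m'). walk_state n k ?q X Y z \<sigma>' \<and>
        (fst z = length X \<or> fst (snd z) = length Y) \<and>
        \<tau>' + (5 * l + 16) * 0 \<le> 1 + (5 * l + 16) * (m' + 1) + 1)
      (exec w X Y walk_program (\<sigma>, 1)) (spmf_of_pmf (counted_walk ?q X Y 0 0 0 0))"
    using w by (intro exec_walk_program q l len) (auto simp: \<sigma>_def initial_store_def walk_state_def)
  have final: "\<exists>\<sigma>''. exec w X Y ?test (\<sigma>', \<tau>') = return_spmf (\<sigma>'', \<tau>' + 2) \<and>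
      (words \<sigma>'' 0 \<noteq> 0 \<longleftrightarrow> cost X Y z \<le> 1296 * k\<^sup>2)"
    if "walk_state n k ?q X Y z \<sigma>'" "fst z = length X \<or> fst (snd z) = length Y" for \<sigma>' \<tau>' z
  proof -
    obtain x y c where z: "z = (x, y, c)" by (cases z)
    have \<sigma>': "words \<sigma>' 2 = k" "words \<sigma>' 3 = length X" "words \<sigma>' 4 = length Y" "words \<sigma>' 5 = x"
      "words \<sigma>' 6 = y" "words \<sigma>' 7 = c" "x \<le> length X" "y \<le> length Y" "c \<le> x + y"
      using that(1) by (auto simp: walk_state_def z)
    have "k * k \<le> 1296 * k\<^sup>2" by (simp add: power2_eq_square)
    then have kk: "(k * k) mod 2 ^ w = k * k" using w(2) by (intro mod_less) linarith
    have kk': "(1296 * (k * k)) mod 2 ^ w = 1296 * (k * k)"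
      using w(2) by (intro mod_less) (simp add: power2_eq_square)
    let ?d = "(length X - x) + (length Y - y)"
    \<comment> \<open>By \<open>c \<le> x + y\<close>, the sum \<open>c + ?d\<close> is at most the
      total length of the strings.\<close>
    have d: "?d mod 2 ^ w = ?d" "(c + ?d) mod 2 ^ w = c + ?d"
      using w(1) len \<sigma>'(7-9) by (intro mod_less; linarith)+
    have "wval w (Mul (Const 1296) (Mul (Word 2) (Word 2))) \<sigma>' = 1296 * k\<^sup>2"
      using w(3) by (simp add: \<sigma>' kk kk' power2_eq_square del: mod_mult_self1_is_0)
    moreover have "wval w (Add (Word 7) (Add (Sub (Word 3) (Word 5)) (Sub (Word 4) (Word 6)))) \<sigma>' = c + ?d"
      by (simp only: wval.simps \<sigma>' d)
    moreover have "cost X Y z = c + ?d" using that(2) by (auto simp: cost_def z)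
    ultimately show ?thesis
      using w0 by (simp del: wval.simps(2-5))
  qed
  have "rel_spmf (\<lambda>(\<sigma>', \<tau>) (z, m). (words \<sigma>' 0 \<noteq> 0 \<longleftrightarrow> cost X Y z \<le> 1296 * k\<^sup>2) \<and>
        \<tau> \<le> (5 * l + 16) * (m + 1) + 4)
      (exec w X Y test_program (initial_store n p k X Y, 0))
      (spmf_of_pmf (bind_pmf (counted_walk ?q X Y 0 0 0 0) return_pmf))"
    unfolding start
  proof (rule rel_spmf_bind_pmfI[OF walk])
    fix a :: "store \<times> nat" and b :: "(nat \<times> nat \<times> nat) \<times> nat"
    obtain \<sigma>' \<tau>' z m where ab: "a = (\<sigma>', \<tau>')" "b = (z, m)" by (cases a, cases b)
    assume "(\<lambda>(\<sigma>', \<tau>') (z, m'). walk_state n k ?q X Y z \<sigma>' \<and>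
        (fst z = length X \<or> fst (snd z) = length Y) \<and>
        \<tau>' + (5 * l + 16) * 0 \<le> 1 + (5 * l + 16) * (m' + 1) + 1) a b"
    then have *: "walk_state n k ?q X Y z \<sigma>'" "fst z = length X \<or> fst (snd z) = length Y"
      "\<tau>' \<le> (5 * l + 16) * (m + 1) + 2"
      by (auto simp: ab)
    obtain \<sigma>'' where "exec w X Y ?test (\<sigma>', \<tau>') = return_spmf (\<sigma>'', \<tau>' + 2)"
      "words \<sigma>'' 0 \<noteq> 0 \<longleftrightarrow> cost X Y z \<le> 1296 * k\<^sup>2"
      using final[OF *(1,2)] by blast
    then show "rel_spmf (\<lambda>(\<sigma>', \<tau>) (z, m). (words \<sigma>' 0 \<noteq> 0 \<longleftrightarrow> cost X Y z \<le> 1296 * k\<^sup>2) \<and>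
        \<tau> \<le> (5 * l + 16) * (m + 1) + 4) (exec w X Y ?test a) (spmf_of_pmf (return_pmf b))"
      using *(3) by (simp only: ab) simp
  qed
  then show ?thesis
    unfolding run_def bind_return_pmf' spmf_rel_map
    by (rule rel_spmf_mono) auto
qed

section \<open>The running time in closed form\<close>

lemma ex_power_two_between: "\<exists>l. n < 2 ^ l \<and> (0 < l \<longrightarrow> 2 ^ (l - 1) \<le> n)" for n :: nat
proof (intro exI conjI impI)
  let ?l = "LEAST l. n < 2 ^ l"
  show "n < 2 ^ ?l" by (rule LeastI[of _ n]) (rule less_exp)
  show "2 ^ (?l - 1) \<le> n" if "0 < ?l"
    using not_less_Least[of "?l - 1" "\<lambda>l. n < 2 ^ l"] that by simp
qed

lemma implementable_walk_test:
  "implementable_in TYPE('a)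
     (\<lambda>n p \<delta>. 193 * (real n / real p) * (1 + ln (real n)) ^ 2 * (1 + ln (1 / \<delta>)) ^ 2)"
  unfolding implementable_in_def
proof (intro exI[of _ test_program] exI[of _ 16] allI impI, elim conjE)
  fix n k p w :: nat and X Y :: "'a list"
  assume n: "1 \<le> n" "1 \<le> p" "2 * ln (real n) \<le> real p" "p \<le> n"
    and len: "length X \<le> n" "length Y \<le> n" and "(n + k + 2) ^ 16 \<le> 2 ^ w"
  let ?q = "2 * ln (real n) / real p"
  let ?W = "counted_walk ?q X Y 0 0 0 0"
  have q: "0 \<le> ?q" "?q \<le> 1" using n by auto
  obtain l where l: "n < 2 ^ l" "0 < l \<Longrightarrow> 2 ^ (l - 1) \<le> n"
    using ex_power_two_between by blast
  let ?s = "n + k + 2"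
  \<comment> \<open>Since \<open>n \<ge> 1\<close>, the base is at least 3; 14 of the 16 factors
    absorb the constants such as 1296.\<close>
  have "(3::nat) ^ 14 * ?s\<^sup>2 \<le> ?s ^ 14 * ?s\<^sup>2"
    using n(1) by (intro mult_le_mono1 power_mono) auto
  also have "\<dots> = ?s ^ 16" by (simp flip: power_add)
  also have "\<dots> \<le> 2 ^ w" by fact
  finally have w: "4782969 * ?s\<^sup>2 \<le> 2 ^ w" by simp
  have "n + 2 \<le> ?s\<^sup>2" "k\<^sup>2 \<le> ?s\<^sup>2"
    by (auto simp: power2_eq_square algebra_simps)
  then have w': "4 * n < 2 ^ w" "1296 * k\<^sup>2 < 2 ^ w" "1296 < (2::nat) ^ w"
    using w by linarith+
  let ?R = "\<lambda>(ans, \<tau>) (z, m). (ans = YES \<longleftrightarrow> cost X Y z \<le> 1296 * k\<^sup>2) \<and> \<tau> \<le> (5 * l + 16) * (m + 1) + 4"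
  have rel: "rel_spmf ?R (run w test_program n p k X Y) (spmf_of_pmf ?W)"
    by (rule run_test_program) (use n l w' len in auto)
  let ?ans = "\<lambda>(z, m :: nat). if cost X Y z \<le> 1296 * k\<^sup>2 then YES else NO"
  have "rel_spmf (=) (map_spmf fst (run w test_program n p k X Y)) (map_spmf ?ans (spmf_of_pmf ?W))"
    unfolding spmf_rel_map using rel
    by (rule rel_spmf_mono) (auto, use answer.exhaust in blast)
  moreover have "map_pmf ?ans ?W = walk_test n p k X Y"
    unfolding walk_test_def map_fst_counted_walk[of ?q X Y 0 0 0 0, symmetric] pmf.map_comp
    by (intro map_pmf_cong refl) (auto simp: cost_def split_def)
  ultimately have "map_spmf fst (run w test_program n p k X Y) = spmf_of_pmf (walk_test n p k X Y)"
    by (simp add: spmf_rel_eq)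
  moreover have "measure (measure_spmf (run w test_program n p k X Y))
      {(ans, \<tau>). real \<tau> > 193 * (real n / real p) * (1 + ln (real n)) ^ 2 * (1 + ln (1 / \<delta>)) ^ 2} \<le> \<delta>"
    if \<delta>: "0 < \<delta>" "\<delta> \<le> 1" for \<delta>
  proof -
    let ?r = "real n / real p" and ?L = "1 + ln (real n)" and ?D = "1 + ln (1 / \<delta>)"
    let ?T = "193 * ?r * ?L ^ 2 * ?D ^ 2"
    let ?len = "real (length X + length Y)"
    \<comment> \<open>Chosen so that the tail bound for the number of samples at \<open>M\<close>
      equals \<open>\<delta>\<close>.\<close>
    define M where "M = 2 * ?q * ?len + ln (1 / \<delta>)"
    have r: "1 \<le> ?r" and L: "1 \<le> ?L" and D: "1 \<le> ?D" using n \<delta> by auto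
    have M: "M + 1 \<le> 9 * (?r * ?L * ?D)"
    proof -
      have "2 * ?q * ?len \<le> 2 * ?q * (2 * real n)"
        using len q by (intro mult_left_mono) auto
      also have "\<dots> = 8 * (?r * ln (real n))" by (simp add: field_simps)
      also have "\<dots> \<le> 8 * (?r * ?L * 1)" using r by (simp only: mult_1_right) (intro mult_left_mono; simp)
      also have "\<dots> \<le> 8 * (?r * ?L * ?D)" using r L D by (intro mult_left_mono) auto
      finally have "2 * ?q * ?len \<le> 8 * (?r * ?L * ?D)" .
      moreover have "1 * 1 * ?D \<le> ?r * ?L * ?D"
        using r L D by (intro mult_mono) auto
      moreover have "u + v + 1 \<le> 9 * z" if "u \<le> 8 * z" "1 * 1 * (1 + v) \<le> z" for u v z :: real
        using that by simp
      ultimately show ?thesis unfolding M_def by blast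
    qed
    have l_le: "real (5 * l + 16) \<le> 21 * ?L"
    proof (cases "l = 0")
      case False
      then have "(2::real) ^ (l - 1) \<le> real n"
        using l(2) by (metis bot_nat_0.not_eq_extremum numeral_power_le_of_nat_cancel_iff)
      then have "ln ((2::real) ^ (l - 1)) \<le> ln (real n)"
        using n(1) by (subst ln_le_cancel_iff) auto
      then have "real (l - 1) * ln 2 \<le> ln (real n)" by (simp add: ln_realpow)
      \<comment> \<open>Then \<open>l \<le> 1 + 2 * ln n\<close>, and
        \<open>5 * l + 16 \<le> 21 + 10 * ln n\<close>.\<close>
      moreover have "real (l - 1) * (1 / 2) \<le> real (l - 1) * ln 2"
        using ln2_ge_two_thirds by (intro mult_left_mono) auto
      ultimately have "real l - 1 \<le> 2 * ln (real n)" using False by (simp add: of_nat_diff)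
      then show ?thesis using L by simp
    qed (use L in simp)
    \<comment> \<open>The constant is \<open>21 * 9 + 4\<close>: time per round, number of rounds,
      and the additive 4.\<close>
    have poly: "21 * u * (9 * (t * u * v)) + 4 * (t * u\<^sup>2 * v) = 193 * t * u\<^sup>2 * v" for t u v :: real
      by (simp add: power2_eq_square)
    have "real (5 * l + 16) * (M + 1) + 4 \<le> 21 * ?L * (9 * (?r * ?L * ?D)) + 4 * (?r * ?L\<^sup>2 * ?D)"
    proof (intro add_mono mult_mono l_le M)
      have "0 \<le> 2 * ?q * ?len" using q(1) by (intro mult_nonneg_nonneg) auto
      moreover have "0 \<le> ln (1 / \<delta>)" using \<delta> by simp
      ultimately have "0 \<le> M" unfolding M_def by (rule add_nonneg_nonneg)
      then show "0 \<le> M + 1" by simp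
      have "1 * 1 * 1 \<le> ?r * ?L\<^sup>2 * ?D" using r L D by (intro mult_mono) auto
      then show "4 \<le> 4 * (?r * ?L\<^sup>2 * ?D)" by simp
    qed (use L in auto)
    also have "\<dots> = 193 * ?r * ?L\<^sup>2 * ?D" by (rule poly)
    \<comment> \<open>The square of \<open>?D\<close> is there because both logarithmic factors
      share one exponent in the theorem.\<close>
    also have "\<dots> \<le> ?T" using r L D by (intro mult_left_mono) (auto simp: self_le_power)
    finally have T: "real (5 * l + 16) * (M + 1) + 4 \<le> ?T" .
    \<comment> \<open>Through the coupling, a run longer than \<open>?T\<close> forces more than
      \<open>M\<close> samples.\<close>
    have "measure (measure_spmf (run w test_program n p k X Y)) {(ans, \<tau>). real \<tau> > ?T} \<le>
        measure (measure_spmf (spmf_of_pmf ?W)) {y. \<exists>x\<in>{(ans, \<tau>). real \<tau> > ?T}. ?R x y}"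
      by (rule rel_spmf_measureD[OF rel])
    also have "\<dots> = measure_pmf.prob ?W {y. \<exists>x\<in>{(ans, \<tau>). real \<tau> > ?T}. ?R x y}" by simp
    also have "\<dots> \<le> measure_pmf.prob ?W {z. M < real (snd z)}"
    proof (rule measure_pmf.finite_measure_mono)
      have "M < real m" if "real \<tau> > ?T" "\<tau> \<le> (5 * l + 16) * (m + 1) + 4" for \<tau> m
      proof -
        have "real \<tau> \<le> real ((5 * l + 16) * (m + 1) + 4)" using that(2) by (simp only: of_nat_le_iff)
        also have "\<dots> = real (5 * l + 16) * (real m + 1) + 4" by (simp add: algebra_simps)
        finally have "real \<tau> \<le> real (5 * l + 16) * (real m + 1) + 4" .
        then have "real (5 * l + 16) * (M + 1) < real (5 * l + 16) * (real m + 1)"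
          using T that(1) by linarith
        then show ?thesis by (subst (asm) mult_less_cancel_left_pos) auto
      qed
      then show "{y. \<exists>x\<in>{(ans, \<tau>). real \<tau> > ?T}. ?R x y} \<subseteq> {z. M < real (snd z)}" by fastforce
    qed simp
    also have "\<dots> \<le> exp (real 0 + 2 * ?q * real ((length X - 0) + (length Y - 0)) - M)"
      by (rule prob_counted_walk_gt[OF q])
    also have "\<dots> = \<delta>" using \<delta> by (simp add: M_def exp_minus ln_div)
    finally show ?thesis .
  qed
  ultimately show "map_spmf fst (run w test_program n p k X Y) = spmf_of_pmf (walk_test n p k X Y) \<and>
      (\<forall>\<delta>. 0 < \<delta> \<and> \<delta> \<le> 1 \<longrightarrow> measure (measure_spmf (run w test_program n p k X Y))
        {(ans, \<tau>). real \<tau> > 193 * (real n / real p) * (1 + ln (real n)) ^ 2 * (1 + ln (1 / \<delta>)) ^ 2} \<le> \<delta>)"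
    by blast
qed

theorem theorem6p1:
  shows "(\<forall>n k p. \<forall>X Y :: 'a list.
            1 \<le> n \<and> 1 \<le> p \<and> 2 * ln (real n) \<le> real p \<and> p \<le> n \<and>
            length X \<le> n \<and> length Y \<le> n \<longrightarrow>
              (edit_distance X Y \<le> k \<longrightarrow> pmf (walk_test n p k X Y) YES \<ge> 2 / 3) \<and>
              (edit_distance X Y \<ge> (1296 * k\<^sup>2 + 1) * p \<longrightarrow>
                 pmf (walk_test n p k X Y) NO \<ge> 1 - 1 / real n))
       \<and> (\<exists>C d. implementable_in TYPE('a)
            (\<lambda>n p \<delta>. C * (real n / real p) * (1 + ln (real n)) ^ d * (1 + ln (1 / \<delta>)) ^ d))"
  using pmf_walk_test_YES_ge pmf_walk_test_NO_ge implementable_walk_test by blast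

end
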